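(* Let $p>1$, let $J$ be a dyadic interval, and let $w$ be a dyadically doubling weight (i.e. $Db^d(w)<\infty$) with $[w]_{RH_p^d}=\delta<\infty$. Put $Q=\max\{Db^d(w),2\}$, let $\varepsilon=\varepsilon(p,\delta,Q)$, and let $s^-=s^-(\varepsilon)$ be the negative solution of $(1-ps^-)^{1/p}(1-s^-)^{-1}=\frac1\varepsilon$. Then: (i) for every $q>1-s^-$ one has $w\in A_q^d$, and moreover $$[w]_{A_q^d}\le\left(\frac{q-1}{q-1+s^-}\right)^{q-1};$$ (ii) for every $q>1-ps^-$ one has $w^p\in A_q^d$, and moreover $$[w^p]_{A_q^d}\le\left(\frac{q-1}{q-1+ps^-}\right)^{q-1}.$$
   Context: Dyadic intervals: $D=\{[n2^{-k},(n+1)2^{-k}]: n,k\in\mathbb{Z}\}$. For $J\in D$, $D(J)=\{I\in D: I\subset J\}$. For $I\in D$, $I^*$ denotes its dyadic parent, i.e. the smallest dyadic interval strictly containing $I$. $\langle f\rangle_I=\frac1{|I|}\int_I f(x)\,dx$. A weight is a locally integrable, almost everywhere positive function $w$ on $\mathbb{R}$. $Db^d(w)=\sup_{I\in D}\frac{\langle w\rangle_{I^*}}{\langle w\rangle_I}$. With $J$ the fixed dyadic interval, the dyadic Reverse Hölder and Muckenhoupt constants on $J$ are $$[w]_{RH_p^d}=\sup_{I\in D(J)}\frac{\langle w^p\rangle_I^{1/p}}{\langle w\rangle_I},\qquad [w]_{A_q^d}=\sup_{I\in D(J)}\langle w\rangle_I\,\langle w^{-\frac1{q-1}}\rangle_I^{\,q-1}\quad(q>1),$$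 and $w\in A_q^d$ means $[w]_{A_q^d}<\infty$. Put $H=\frac{Q^p-1}{Q-1}$ and $\varepsilon(p,\delta,Q)=\frac{H}{p}\left(\frac{p-1}{H-1}\right)^{\frac{p-1}{p}}\delta$. *)

theory Defs
  imports "HOL-Analysis.Analysis"
begin

definition dyadic_intervals :: "real set set" where
  "dyadic_intervals =
     {{real_of_int n * 2 powi (-k) .. (real_of_int n + 1) * 2 powi (-k)} | n k :: int. True}"

definition dyadic_in :: "real set \<Rightarrow> real set set" where
  "dyadic_in J = {I \<in> dyadic_intervals. I \<subseteq> J}"

text \<open>The order on sets is inclusion, so the \<open>LEAST\<close> below is the smallest dyadic interval
  strictly containing \<open>I\<close>.\<close>

definition dyadic_parent :: "real set \<Rightarrow> real set" where
  "dyadic_parent I = (LEAST K. K \<in> dyadic_intervals \<and> I \<subset> K)"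

definition weight :: "(real \<Rightarrow> real) \<Rightarrow> bool" where
  "weight w \<longleftrightarrow>
     (\<forall>K. compact K \<longrightarrow> w absolutely_integrable_on K) \<and> (AE x in lebesgue. 0 < w x)"

text \<open>Averages and the constants built from them are \<open>[0, \<infinity>]\<close>-valued, since powers of a weight
  need not be locally integrable and the suprema may be infinite. The coercion \<open>ennreal\<close> sends
  negative numbers to 0; all functions averaged below are almost everywhere positive.\<close>

definition avg :: "(real \<Rightarrow> real) \<Rightarrow> real set \<Rightarrow> ennreal" where
  "avg f I = (\<integral>\<^sup>+x\<in>I. ennreal (f x) \<partial>lebesgue) / emeasure lebesgue I"

text \<open>Real powers on \<open>[0, \<infinity>]\<close>; used only with exponent \<open>a > 0\<close>.\<close>

definition epowr :: "ennreal \<Rightarrow> real \<Rightarrow> ennreal" where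
  "epowr x a = (if x = \<infinity> then \<infinity> else ennreal (enn2real x powr a))"

definition Db :: "(real \<Rightarrow> real) \<Rightarrow> ennreal" where
  "Db w = (SUP I\<in>dyadic_intervals. avg w (dyadic_parent I) / avg w I)"

definition RH_const :: "real set \<Rightarrow> real \<Rightarrow> (real \<Rightarrow> real) \<Rightarrow> ennreal" where
  "RH_const J p w = (SUP I\<in>dyadic_in J. epowr (avg (\<lambda>x. w x powr p) I) (1 / p) / avg w I)"

definition A_const :: "real set \<Rightarrow> real \<Rightarrow> (real \<Rightarrow> real) \<Rightarrow> ennreal" where
  "A_const J q w =
     (SUP I\<in>dyadic_in J. avg w I * epowr (avg (\<lambda>x. w x powr (- 1 / (q - 1))) I) (q - 1))"

definition A_class :: "real set \<Rightarrow> real \<Rightarrow> (real \<Rightarrow> real) set" where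
  "A_class J q = {w. A_const J q w < \<infinity>}"

definition H_const :: "real \<Rightarrow> real \<Rightarrow> real" where
  "H_const p Q = (Q powr p - 1) / (Q - 1)"

definition eps :: "real \<Rightarrow> real \<Rightarrow> real \<Rightarrow> real" where
  "eps p \<delta> Q =
     H_const p Q / p * ((p - 1) / (H_const p Q - 1)) powr ((p - 1) / p) * \<delta>"

text \<open>For \<open>p > 1\<close> the left-hand side of the equation increases strictly from 0 to 1 on the
  negative half-line, so the solution exists and is unique when \<open>\<epsilon> > 1\<close>. This is the case for
  \<open>\<epsilon> = eps p \<delta> Q\<close> with \<open>\<delta> \<ge> 1\<close> and \<open>Q \<ge> 2\<close>, because then \<open>H_const p Q > p\<close>.\<close>

definition s_minus :: "real \<Rightarrow> real \<Rightarrow> real" where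
  "s_minus p \<epsilon> = (THE s. s < 0 \<and> (1 - p * s) powr (1 / p) * inverse (1 - s) = 1 / \<epsilon>)"

end

theory Submission
  imports Defs "HOL-Real_Asymp.Real_Asymp"
begin

text \<open>
  Put \<open>\<sigma> = - s > 0\<close>. Both parts follow from one estimate (\<open>avg_neg_powr_le\<close>): if \<open>\<rho> > 0\<close> and
  \<open>\<rho> \<sigma> < 1\<close>, then on every dyadic \<open>I \<subseteq> J\<close>
  \<open>\<langle>w^{-\<rho>}\<rangle>_I \<le> \<langle>w^p\<rangle>_I^{-\<rho>/p} / (1 - \<rho> \<sigma>)\<close>.
  For \<open>\<rho> = p / (q - 1)\<close> this is the bound for \<open>w powr p\<close>; for \<open>\<rho> = 1 / (q - 1)\<close> it gives the bound for
  \<open>w\<close>, because \<open>\<langle>w\<rangle>_I\<close> is at most \<open>\<langle>w^p\<rangle>_I^{1/p}\<close>.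

  The estimate is proved by a Bellman function. To each \<open>I\<close> belongs the point
  \<open>(x, y) = (\<langle>w\<rangle>_I, \<langle>w^p\<rangle>_I)\<close>, the midpoint of the points of the two halves of \<open>I\<close>. All these
  points satisfy \<open>x^p \<le> y \<le> \<delta>^p x^p\<close>. Doubling bounds by \<open>Q\<close> the ratio of the abscissas of the points of
  \<open>I\<close> and of a half of \<open>I\<close>, and \<open>\<epsilon>\<close> is such that a segment with ends in this region and
  ratio at most \<open>Q\<close> stays in the larger region \<open>x^p \<le> y \<le> \<epsilon>^p x^p\<close> (\<open>segment_in_enlarged_domain\<close>).
  The equation for \<open>s\<close> says that \<open>\<epsilon>^p = (1 + \<sigma>)^p / (1 + p \<sigma>)\<close>.

  On the larger region there is a function \<open>B\<close> that is concave along all segments in the region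
  and lies between \<open>x^{-\<rho>}\<close> and \<open>y^{-\<rho>/p} / (1 - \<rho> \<sigma>)\<close> (\<open>bellman_midpoint_concave\<close>, \<open>bellman_lower\<close>,
  \<open>bellman_upper\<close>). It is affine along the tangents to the upper boundary: on the tangent through
  the lower boundary point \<open>(u, u^p)\<close> that touches the upper boundary at the abscissa \<open>u / (1 + \<sigma>)\<close>,
  it interpolates between the averages of \<open>w^{-\<rho>}\<close> for the constant weight \<open>u\<close> and for the
  weight \<open>u t^\<sigma>\<close> on \<open>(0, 1)\<close>. Concavity comes from an envelope argument: the affine functions
  belonging to the tangents form a one-parameter family, and at a given point the parameter of the
  tangent through that point minimizes over all parameters that can occur for points visible
  from it.

  Iterating concavity over the dyadic descendants of \<open>I\<close> bounds the mean of \<open>\<langle>w\<rangle>_K^{-\<rho>}\<close> over the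
  descendants \<open>K\<close> of a fixed generation by \<open>B\<close> at the point of \<open>I\<close>
  (\<open>dyadic_supersolution_nn_integral\<close>). Lebesgue differentiation
  (\<open>dyadic_averages_converge\<close>) and Fatou's lemma then give the estimate.
\<close>

section \<open>Chords of the power function and the constant epsilon\<close>

lemma powr_above_tangent:
  fixes p t z :: real
  assumes "1 < p" "0 < t" "0 \<le> z"
  shows "t powr p + p * t powr (p - 1) * (z - t) \<le> z powr p"
    and "z \<noteq> t \<Longrightarrow> t powr p + p * t powr (p - 1) * (z - t) < z powr p"
proof -
  have d: "((\<lambda>x. x powr p) has_real_derivative p * x powr (p - 1)) (at x)" if "0 < x" for x
    using that by (rule has_real_derivative_powr)
  show *: "t powr p + p * t powr (p - 1) * (z - t) < z powr p" if "z \<noteq> t"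
  proof (cases "t < z")
    case True
    obtain x where x: "t < x" "x < z" "z powr p - t powr p = (z - t) * (p * x powr (p - 1))"
      using MVT2[OF True, of "\<lambda>x. x powr p" "\<lambda>x. p * x powr (p - 1)"] d assms by force
    have "t powr (p - 1) < x powr (p - 1)"
      using x assms by (intro powr_less_mono2) auto
    then have "(z - t) * (p * t powr (p - 1)) < (z - t) * (p * x powr (p - 1))"
      using True assms by (intro mult_strict_left_mono) auto
    then show ?thesis using x by (simp add: algebra_simps)
  next
    case False
    then have lt: "z < t" using that by simp
    show ?thesis
    proof (cases "z = 0")
      case True
      have "t powr (p - 1) * t = t powr p" using assms by (simp add: powr_diff)
      then show ?thesis using True assms by (simp add: algebra_simps)
    next
      case False
      obtain x where x: "z < x" "x < t" "t powr p - z powr p = (t - z) * (p * x powr (p - 1))"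
        using MVT2[OF lt, of "\<lambda>x. x powr p" "\<lambda>x. p * x powr (p - 1)"] d assms False by force
      have "x powr (p - 1) < t powr (p - 1)"
        using x assms by (intro powr_less_mono2) auto
      then have "(t - z) * (p * x powr (p - 1)) < (t - z) * (p * t powr (p - 1))"
        using lt assms by (intro mult_strict_left_mono) auto
      then show ?thesis using x by (simp add: algebra_simps)
    qed
  qed
  show "t powr p + p * t powr (p - 1) * (z - t) \<le> z powr p"
    using * by (cases "z = t") force+
qed

text \<open>With \<open>H = (Q powr p - 1) / (Q - 1)\<close> this is the \<open>p\<close>-th power of
  \<open>\<epsilon>(p, \<delta>, Q) / \<delta>\<close>.\<close>

definition chord_factor :: "real \<Rightarrow> real \<Rightarrow> real" where
  "chord_factor p H = ((H / p) * ((p - 1) / (H - 1)) powr ((p - 1) / p)) powr p"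

text \<open>The abscissa at which the line \<open>1 + H (z - 1)\<close> touches the curve
  \<open>chord_factor p H * z powr p\<close> is \<open>p (H - 1) / ((p - 1) H)\<close>; this is the common height there.\<close>

lemma chord_factor_touch:
  assumes "1 < p" "1 < H"
  shows "chord_factor p H * (p * (H - 1) / ((p - 1) * H)) powr p = (H - 1) / (p - 1)"
proof -
  define k where "k = (p - 1) / (H - 1)"
  have k: "0 < k" using assms by (simp add: k_def)
  have "chord_factor p H = (H / p) powr p * k powr (p - 1)"
    unfolding chord_factor_def k_def[symmetric]
    using assms by (simp only: powr_mult powr_powr) simp
  moreover have "p * (H - 1) / ((p - 1) * H) = inverse (H / p) * inverse k"
    using assms by (simp add: k_def)
  then have "(p * (H - 1) / ((p - 1) * H)) powr p = inverse ((H / p) powr p) * inverse (k powr p)"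
    by (simp only: powr_mult inverse_powr)
  ultimately have "chord_factor p H * (p * (H - 1) / ((p - 1) * H)) powr p = k powr (p - 1) / k powr p"
    using assms by (simp add: field_simps)
  also have "\<dots> = inverse k"
    using k by (simp add: powr_diff inverse_eq_divide)
  finally show ?thesis by (simp add: k_def)
qed

lemma chord_factor_tangent:
  assumes "1 < p" "1 < H"
  defines "t \<equiv> p * (H - 1) / ((p - 1) * H)"
  shows "chord_factor p H * (t powr p + p * t powr (p - 1) * (z - t)) = 1 + H * (z - 1)"
proof -
  define E where "E = chord_factor p H"
  have t: "0 < t" using assms(1,2) by (simp add: t_def)
  have Et: "E * t powr p = (H - 1) / (p - 1)"
    unfolding E_def t_def using assms(1,2) by (rule chord_factor_touch)
  have "t powr (p - 1) = t powr p / t" using t by (simp add: powr_diff)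
  then have "E * (t powr p + p * t powr (p - 1) * (z - t)) = (E * t powr p) * (1 + p * (z - t) / t)"
    by (simp add: algebra_simps)
  also have "\<dots> = (H - 1) / (p - 1) * (1 - p) + (H - 1) / (p - 1) * p * z / t"
  proof -
    have "1 + p * (z - t) / t = (1 - p) + p * z / t"
      using t by (simp add: field_simps)
    then show ?thesis unfolding Et by (simp only: distrib_left times_divide_eq_right mult.assoc)
  qed
  also have "(H - 1) / (p - 1) * p * z / t = H * z"
    using assms(1,2) by (simp add: t_def)
  also have "(H - 1) / (p - 1) * (1 - p) = 1 - H"
    using assms(1,2) by (simp add: field_simps)
  finally show ?thesis by (simp add: E_def algebra_simps)
qed

text \<open>This is what the constant \<open>chord_factor\<close> is made for: it is the least factor by which
  \<open>z powr p\<close> has to be multiplied to lie above the line through \<open>(1, 1)\<close> of slope \<open>H\<close>. The line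
  is the tangent of the multiplied curve, so convexity gives the inequality.\<close>

lemma chord_le_chord_factor:
  assumes "1 < p" "1 < H" "0 \<le> z"
  shows "1 + H * (z - 1) \<le> chord_factor p H * z powr p"
  unfolding chord_factor_tangent[OF assms(1,2), symmetric]
  using assms
  by (intro mult_left_mono powr_above_tangent(1)) (auto simp: chord_factor_def)

text \<open>The line of slope \<open>H\<close> crosses \<open>z powr p\<close> transversally at \<open>z = 1\<close> when \<open>H\<close> exceeds the
  slope \<open>p\<close> of the curve there, so the curve has to be lifted strictly.\<close>

lemma chord_factor_gt_1:
  assumes "1 < p" "p < H"
  shows "1 < chord_factor p H"
proof -
  define t where "t = p * (H - 1) / ((p - 1) * H)"
  have t: "0 < t" "1 \<noteq> t" using assms by (auto simp: t_def field_simps)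
  have "0 < chord_factor p H" using assms by (simp add: chord_factor_def)
  then have "chord_factor p H * (t powr p + p * t powr (p - 1) * (1 - t)) < chord_factor p H * 1 powr p"
    using assms t powr_above_tangent(2)[of p t 1] by (intro mult_strict_left_mono) auto
  moreover have "chord_factor p H * (t powr p + p * t powr (p - 1) * (1 - t)) = 1 + H * (1 - 1)"
    unfolding t_def using assms by (intro chord_factor_tangent) auto
  ultimately show ?thesis by simp
qed

lemma powr_slope_gt:
  fixes p Q :: real
  assumes "1 < p" "1 < Q"
  shows "p < (Q powr p - 1) / (Q - 1)"
  using powr_above_tangent(2)[of p 1 Q] assms by (simp add: field_simps)

lemma powr_le_chord:
  fixes p b c t :: real
  assumes "1 < p" "0 < b" "0 < c" "0 \<le> t" "t \<le> 1"
  shows "((1 - t) * b + t * c) powr p \<le> (1 - t) * b powr p + t * c powr p"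
  using convex_onD[OF powr_convex[of p], of t b c] assms by simp

lemma powr_chord_le:
  fixes p b Q :: real
  assumes "1 < p" "1 \<le> b" "b \<le> Q" "1 < Q"
  shows "b powr p \<le> 1 + (Q powr p - 1) / (Q - 1) * (b - 1)"
proof -
  define t where "t = (b - 1) / (Q - 1)"
  have t: "0 \<le> t" "t \<le> 1" using assms by (auto simp: t_def)
  have "t * (Q - 1) = b - 1" using assms by (simp add: t_def)
  then have "(1 - t) * 1 + t * Q = b" by (simp add: algebra_simps)
  then have "b powr p \<le> (1 - t) + t * Q powr p"
    using powr_le_chord[of p 1 Q t] t assms by simp
  also have "\<dots> = 1 + (Q powr p - 1) * t" by (simp add: algebra_simps)
  finally show ?thesis by (simp add: t_def)
qed

text \<open>After scaling to \<open>x = 1\<close>, the worst pair of points lies on the upper boundary, with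
  abscissas \<open>1\<close> and \<open>b \<le> Q\<close>. The chord joining them lies below the line through \<open>(1, D)\<close> of
  slope \<open>D * H\<close>, since chord slopes of a convex function increase with \<open>b\<close>.\<close>

lemma segment_in_enlarged_domain_ordered:
  fixes p D Q x x' y y' t :: real
  assumes p: "1 < p" and Q: "1 < Q" and d: "0 \<le> D"
    and x: "0 < x" "y \<le> D * x powr p" and x': "x \<le> x'" "x' \<le> Q * x" "y' \<le> D * x' powr p"
    and t: "0 \<le> t" "t \<le> 1"
  shows "(1 - t) * y + t * y' \<le>
    D * chord_factor p ((Q powr p - 1) / (Q - 1)) * ((1 - t) * x + t * x') powr p"
proof -
  define H where "H = (Q powr p - 1) / (Q - 1)"
  have H: "1 < H" using powr_slope_gt[OF p Q] p by (simp add: H_def)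
  define b where "b = x' / x"
  have b: "1 \<le> b" "b \<le> Q" "x' = b * x" using x x' by (auto simp: b_def field_simps)
  define z where "z = 1 + t * (b - 1)"
  have z: "1 \<le> z" using b t by (simp add: z_def)
  have "(1 - t) * y + t * y' \<le> (1 - t) * (D * x powr p) + t * (D * x' powr p)"
    using x x' t by (intro add_mono mult_left_mono) auto
  also have "\<dots> = D * x powr p * (1 + t * (b powr p - 1))"
    unfolding b by (simp add: powr_mult algebra_simps)
  also have "\<dots> \<le> D * x powr p * (1 + t * (H * (b - 1)))"
    using powr_chord_le[OF p b(1,2) Q] d t by (intro mult_left_mono add_left_mono) (auto simp: H_def)
  also have "\<dots> = D * x powr p * (1 + H * (z - 1))"
    by (simp add: z_def algebra_simps)
  also have "\<dots> \<le> D * x powr p * (chord_factor p H * z powr p)"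
    using chord_le_chord_factor(1)[OF p H, of z] z d by (intro mult_left_mono) auto
  also have "\<dots> = D * chord_factor p H * (z * x) powr p"
    by (simp add: powr_mult)
  also have "z * x = (1 - t) * x + t * x'"
    by (simp add: z_def b algebra_simps)
  finally show ?thesis by (simp add: H_def)
qed

text \<open>A segment whose ends lie below the curve \<open>D * x powr p\<close> and have abscissas of ratio at most
  \<open>Q\<close> stays below the curve lifted by \<open>chord_factor\<close>. Here the doubling constant enters.\<close>

lemma segment_in_enlarged_domain:
  fixes p D Q x x' y y' t :: real
  assumes p: "1 < p" and Q: "1 < Q" and d: "0 \<le> D"
    and x: "0 < x" "y \<le> D * x powr p" and x': "0 < x'" "y' \<le> D * x' powr p"
    and ratio: "x' \<le> Q * x" "x \<le> Q * x'"
    and t: "0 \<le> t" "t \<le> 1"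
  shows "(1 - t) * y + t * y' \<le>
    D * chord_factor p ((Q powr p - 1) / (Q - 1)) * ((1 - t) * x + t * x') powr p"
proof (cases "x \<le> x'")
  case True
  then show ?thesis using assms by (intro segment_in_enlarged_domain_ordered) auto
next
  case False
  have "(1 - (1 - t)) * y' + (1 - t) * y \<le>
    D * chord_factor p ((Q powr p - 1) / (Q - 1)) * ((1 - (1 - t)) * x' + (1 - t) * x) powr p"
    using assms False by (intro segment_in_enlarged_domain_ordered) auto
  then show ?thesis by (simp add: add.commute)
qed

text \<open>For \<open>w x = x powr (- s)\<close> on \<open>(0, 1)\<close> one has \<open>\<langle>w\<rangle> = 1 / (1 - s)\<close> and
  \<open>\<langle>w powr p\<rangle> = 1 / (1 - p s)\<close>, so the equation says that the ratio of \<open>\<langle>w powr p\<rangle> powr (1 / p)\<close> to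
  \<open>\<langle>w\<rangle>\<close> is \<open>\<epsilon>\<close>. The left-hand side increases strictly from \<open>0\<close> at \<open>-\<infinity>\<close> to \<open>1\<close> at \<open>0\<close>.\<close>

lemma power_function_ratio_solution:
  fixes p \<epsilon> :: real
  assumes p: "1 < p" and e: "1 < \<epsilon>"
  shows "\<exists>!s. s < 0 \<and> (1 - p * s) powr (1 / p) * inverse (1 - s) = 1 / \<epsilon>"
proof -
  define f where "f s = (1 - p * s) powr (1 / p) * inverse (1 - s)" for s
  have cont: "continuous_on {a..b} f" if "b \<le> 0" for a b
    unfolding f_def using that p
  proof (intro continuous_intros ballI)
    fix x assume "x \<in> {a..b}"
    then have "x \<le> 0" using that by simp
    then have "p * x \<le> 0" using p by (simp add: mult_nonneg_nonpos)
    then show "1 - p * x \<noteq> 0" "1 - x \<noteq> 0" using \<open>x \<le> 0\<close> by auto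
  qed
  have less: "f a < f b" if "a < b" "b \<le> 0" for a b
  proof (rule DERIV_pos_imp_increasing_open[OF that(1)])
    fix s assume s: "a < s" "s < b"
    then have s0: "s < 0" using that by simp
    then have "p * s < 0" using p by (simp add: mult_pos_neg)
    then have pos: "0 < 1 - p * s" "0 < 1 - s" using s0 by auto
    have 1: "(f has_real_derivative ((1 / p) * (1 - p * s) powr (1 / p - 1) * (- p)) * inverse (1 - s)
        + (1 - p * s) powr (1 / p) * inverse ((1 - s)^2)) (at s)"
      unfolding f_def[abs_def] using pos
      by (auto intro!: derivative_eq_intros simp: power2_eq_square)
    have 2: "(1 - p * s) powr (1 / p) = (1 - p * s) powr (1 / p - 1) * (1 - p * s)"
      using pos by (simp add: powr_diff)
    have "((1 / p) * (1 - p * s) powr (1 / p - 1) * (- p)) * inverse (1 - s)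
        + (1 - p * s) powr (1 / p) * inverse ((1 - s)^2)
      = (1 - p * s) powr (1 / p - 1) * inverse ((1 - s)^2) * ((1 - p * s) - (1 - s))"
    proof -
      define k where "k = (1 - p * s) powr (1 / p - 1)"
      have h: "inverse (1 - s) = inverse ((1 - s)^2) * (1 - s)"
        using pos by (simp add: power2_eq_square)
      then show ?thesis
        unfolding 2 k_def[symmetric] h using p by (simp add: algebra_simps)
    qed
    also have "\<dots> = (1 - p * s) powr (1 / p - 1) * inverse ((1 - s)^2) * ((p - 1) * (- s))"
      by (simp add: algebra_simps)
    also have "0 < \<dots>" using p pos s0 by (intro mult_pos_pos) auto
    finally show "\<exists>D. (f has_real_derivative D) (at s) \<and> 0 < D" using 1 by blast
  next
    show "continuous_on {a..b} f" using cont that by auto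
  qed
  have "f 0 = 1" by (simp add: f_def)
  have "(f \<longlongrightarrow> 0) at_bot"
    unfolding f_def using p by real_asymp
  then have "\<forall>\<^sub>F s in at_bot. f s < 1 / \<epsilon>"
    using e by (intro order_tendstoD) auto
  then have "\<forall>\<^sub>F s in at_bot. f s < 1 / \<epsilon> \<and> s < 0"
    using eventually_gt_at_bot by (rule eventually_conj)
  then obtain m where m: "f m < 1 / \<epsilon>" "m < 0"
    using eventually_happens[of _ "at_bot :: real filter"] by auto
  have "\<exists>s. m \<le> s \<and> s \<le> 0 \<and> f s = 1 / \<epsilon>"
    using m e \<open>f 0 = 1\<close> cont by (intro IVT') auto
  then obtain s where s: "s \<le> 0" "f s = 1 / \<epsilon>" by blast
  then have "s < 0" using e \<open>f 0 = 1\<close> by (cases "s = 0") auto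
  show ?thesis
    unfolding f_def[symmetric]
  proof (rule ex1I[of _ s])
    show "s < 0 \<and> f s = 1 / \<epsilon>" using s \<open>s < 0\<close> by simp
    fix r assume "r < 0 \<and> f r = 1 / \<epsilon>"
    then show "r = s"
      using less[of r s] less[of s r] s \<open>s < 0\<close> by (cases r s rule: linorder_cases) auto
  qed
qed

lemma eps_powr_eq:
  shows "eps p \<delta> Q powr p = \<delta> powr p * chord_factor p ((Q powr p - 1) / (Q - 1))"
  unfolding eps_def H_const_def chord_factor_def by (subst powr_mult) (rule mult.commute)

section \<open>The Bellman function\<close>

text \<open>The curve \<open>(1 + p * \<sigma>) * y = (1 + \<sigma>) powr p * x powr p\<close> bounds the domain below from above. Its
  tangent at the abscissa \<open>u / (1 + \<sigma>)\<close> passes through the point \<open>(u, u powr p)\<close> of the lower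
  boundary. The gap is a positive multiple of the signed height of \<open>(x, y)\<close> above this tangent.\<close>

definition tangent_gap :: "real \<Rightarrow> real \<Rightarrow> real \<Rightarrow> real \<Rightarrow> real \<Rightarrow> real" where
  "tangent_gap p \<sigma> u x y =
     (1 + p * \<sigma>) * y - p * (1 + \<sigma>) * u powr (p - 1) * x + (p - 1) * u powr p"

text \<open>Along each of the tangents above, the Bellman function is to be affine, with one affine
  function supporting it from above along the whole tangent. Such a family in \<open>(x, y)\<close> must have a
  \<open>u\<close>-derivative that vanishes on the \<open>u\<close>-th tangent; together with homogeneity under
  \<open>(x, y, u) \<mapsto> (c x, c powr p * y, c u)\<close> and the value \<open>u powr (- \<rho>)\<close> at \<open>(u, u powr p)\<close>
  this determines the coefficients.\<close>

definition support_plane :: "real \<Rightarrow> real \<Rightarrow> real \<Rightarrow> real \<Rightarrow> real \<Rightarrow> real \<Rightarrow> real" where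
  "support_plane p \<sigma> \<rho> u x y =
     ((p - 1) * (\<rho> + 1) * (\<rho> + p) * u powr (- \<rho>)
      - p * \<rho> * (\<rho> + p) * (1 + \<sigma>) * x * u powr (- \<rho> - 1)
      + \<rho> * (\<rho> + 1) * (1 + p * \<sigma>) * y * u powr (- \<rho> - p))
     / (p * (p - 1) * (1 - \<rho> * \<sigma>))"

definition in_domain :: "real \<Rightarrow> real \<Rightarrow> real \<Rightarrow> real \<Rightarrow> bool" where
  "in_domain p \<sigma> x y \<longleftrightarrow>
     0 < x \<and> x powr p \<le> y \<and> (1 + p * \<sigma>) * y \<le> (1 + \<sigma>) powr p * x powr p"

text \<open>Of the two tangents through a point of the domain, this selects the one that touches the
  upper boundary at or to the left of the point.\<close>

definition touching :: "real \<Rightarrow> real \<Rightarrow> real \<Rightarrow> real \<Rightarrow> real \<Rightarrow> bool" where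
  "touching p \<sigma> u x y \<longleftrightarrow> x \<le> u \<and> u \<le> (1 + \<sigma>) * x \<and> tangent_gap p \<sigma> u x y = 0"

definition bellman :: "real \<Rightarrow> real \<Rightarrow> real \<Rightarrow> real \<Rightarrow> real \<Rightarrow> real" where
  "bellman p \<sigma> \<rho> x y = support_plane p \<sigma> \<rho> (SOME u. touching p \<sigma> u x y) x y"

lemma powr_minus_one_mult: "u powr (p - 1) * u = u powr p" if "0 < u" for u p :: real
  using that by (simp add: powr_diff)

lemma tangent_gap_at_contact:
  assumes "0 < x" "0 \<le> \<sigma>"
  shows "tangent_gap p \<sigma> ((1 + \<sigma>) * x) x y = (1 + p * \<sigma>) * y - (1 + \<sigma>) powr p * x powr p"
proof -
  have "((1 + \<sigma>) * x) powr (p - 1) * ((1 + \<sigma>) * x) = ((1 + \<sigma>) * x) powr p"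
    using assms by (intro powr_minus_one_mult) auto
  then have "p * (1 + \<sigma>) * ((1 + \<sigma>) * x) powr (p - 1) * x = p * ((1 + \<sigma>) * x) powr p"
    by (metis (no_types, lifting) mult.assoc mult.commute)
  moreover have "((1 + \<sigma>) * x) powr p = (1 + \<sigma>) powr p * x powr p"
    by (rule powr_mult)
  ultimately show ?thesis
    unfolding tangent_gap_def by algebra
qed

lemma touching_exists:
  assumes "1 < p" "0 < \<sigma>" "in_domain p \<sigma> x y"
  shows "\<exists>u. touching p \<sigma> u x y"
proof -
  have x: "0 < x" "x powr p \<le> y" "(1 + p * \<sigma>) * y \<le> (1 + \<sigma>) powr p * x powr p"
    using assms by (auto simp: in_domain_def)
  have "tangent_gap p \<sigma> x x y = (1 + p * \<sigma>) * y - p * (1 + \<sigma>) * (x powr (p - 1) * x) + (p - 1) * x powr p"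
    by (simp add: tangent_gap_def)
  also have "\<dots> = (1 + p * \<sigma>) * (y - x powr p)"
    using x powr_minus_one_mult[of x p] by (simp add: algebra_simps)
  also have "\<dots> \<ge> 0"
    using assms x by (intro mult_nonneg_nonneg) (auto intro: add_nonneg_nonneg)
  finally have left: "0 \<le> tangent_gap p \<sigma> x x y" .
  have right: "tangent_gap p \<sigma> ((1 + \<sigma>) * x) x y \<le> 0"
    using x assms tangent_gap_at_contact[of x \<sigma> p y] by simp
  have "continuous_on {x .. (1 + \<sigma>) * x} (\<lambda>u. tangent_gap p \<sigma> u x y)"
    unfolding tangent_gap_def using x by (intro continuous_intros) auto
  moreover have "x \<le> (1 + \<sigma>) * x"
    using x assms by (simp add: algebra_simps)
  ultimately show ?thesis
    using IVT2'[of "\<lambda>u. tangent_gap p \<sigma> u x y" "(1 + \<sigma>) * x" 0 x] left right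
    by (auto simp: touching_def)
qed

lemma tangent_gap_deriv:
  assumes "0 < u"
  shows "((\<lambda>u. tangent_gap p \<sigma> u x y) has_real_derivative
           p * (p - 1) * u powr (p - 2) * (u - (1 + \<sigma>) * x)) (at u)"
proof -
  have e: "u powr (p - 1) = u powr (p - 2) * u"
    using powr_minus_one_mult[of u "p - 1"] assms by simp
  have "((\<lambda>u. tangent_gap p \<sigma> u x y) has_real_derivative
           - p * (1 + \<sigma>) * ((p - 1) * u powr (p - 2)) * x + (p - 1) * (p * u powr (p - 1))) (at u)"
    unfolding tangent_gap_def using assms
    by (auto intro!: derivative_eq_intros simp: field_simps)
  then show ?thesis
    unfolding e by (simp add: algebra_simps)
qed

text \<open>The envelope property for which the coefficients were chosen. For \<open>p > 1\<close>, \<open>\<rho> > 0\<close> and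
  \<open>\<rho> * \<sigma> < 1\<close> the plane decreases in \<open>u\<close> exactly where the point lies above the tangent.\<close>

lemma support_plane_deriv:
  assumes "0 < u"
  shows "((\<lambda>u. support_plane p \<sigma> \<rho> u x y) has_real_derivative
           - (\<rho> * (\<rho> + 1) * (\<rho> + p) / (p * (p - 1) * (1 - \<rho> * \<sigma>)))
             * u powr (- \<rho> - p - 1) * tangent_gap p \<sigma> u x y) (at u)"
proof -
  have e: "u powr (- \<rho> - 1) = u powr (- \<rho> - p - 1) * u powr p"
    "u powr (- \<rho> - 2) = u powr (- \<rho> - p - 1) * u powr (p - 1)"
    by (simp_all add: powr_add[symmetric])
  have "((\<lambda>u. support_plane p \<sigma> \<rho> u x y) has_real_derivative
      ((p - 1) * (\<rho> + 1) * (\<rho> + p) * (- \<rho> * u powr (- \<rho> - 1))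
      - p * \<rho> * (\<rho> + p) * (1 + \<sigma>) * x * ((- \<rho> - 1) * u powr (- \<rho> - 2))
      + \<rho> * (\<rho> + 1) * (1 + p * \<sigma>) * y * ((- \<rho> - p) * u powr (- \<rho> - p - 1)))
     / (p * (p - 1) * (1 - \<rho> * \<sigma>))) (at u)"
  proof -
    have *: "((\<lambda>u. u powr r) has_real_derivative r * u powr (r - 1)) (at u)" for r
      using assms by (rule has_real_derivative_powr)
    have **: "- \<rho> - 1 - 1 = - \<rho> - 2" by simp
    show ?thesis
      unfolding support_plane_def
      using *[of "- \<rho>"] *[of "- \<rho> - 1", unfolded **] *[of "- \<rho> - p"]
      by (intro DERIV_cdivide DERIV_add DERIV_diff DERIV_cmult) auto
  qed
  moreover have "((p - 1) * (\<rho> + 1) * (\<rho> + p) * (- \<rho> * u powr (- \<rho> - 1))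
      - p * \<rho> * (\<rho> + p) * (1 + \<sigma>) * x * ((- \<rho> - 1) * u powr (- \<rho> - 2))
      + \<rho> * (\<rho> + 1) * (1 + p * \<sigma>) * y * ((- \<rho> - p) * u powr (- \<rho> - p - 1)))
     = - (\<rho> * (\<rho> + 1) * (\<rho> + p)) * u powr (- \<rho> - p - 1) * tangent_gap p \<sigma> u x y"
    unfolding e tangent_gap_def by algebra
  ultimately show ?thesis by simp
qed

text \<open>On the tangent the ordinate can be eliminated, and the plane depends on \<open>x / u\<close> only.\<close>

lemma support_plane_on_tangent:
  assumes "1 < p" "0 < u" "0 < 1 - \<rho> * \<sigma>" "tangent_gap p \<sigma> u x y = 0"
  shows "support_plane p \<sigma> \<rho> u x y =
    u powr (- \<rho>) * (\<rho> + 1 - \<rho> * (1 + \<sigma>) * (x / u)) / (1 - \<rho> * \<sigma>)"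
proof -
  have e: "u powr (- \<rho> - 1) = u powr (- \<rho>) / u"
          "u powr (- \<rho> - p) = u powr (- \<rho>) / u powr p"
          "u powr (p - 1) = u powr p / u"
    using assms by (simp_all add: powr_diff)
  define A where "A = u powr p"
  have A: "0 < A" using assms by (simp add: A_def)
  have gap: "(1 + p * \<sigma>) * y = p * (1 + \<sigma>) * (A / u) * x - (p - 1) * A"
    using assms(4) unfolding tangent_gap_def e A_def by simp
  have "(1 + p * \<sigma>) * y / A = p * (1 + \<sigma>) * (x / u) - (p - 1)"
    unfolding gap using A by (simp add: field_simps)
  moreover have "support_plane p \<sigma> \<rho> u x y = u powr (- \<rho>) *
     ((p - 1) * (\<rho> + 1) * (\<rho> + p) - p * \<rho> * (\<rho> + p) * (1 + \<sigma>) * (x / u)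
      + \<rho> * (\<rho> + 1) * ((1 + p * \<sigma>) * y / A)) / (p * (p - 1) * (1 - \<rho> * \<sigma>))"
    unfolding support_plane_def e A_def
    by (intro arg_cong[of _ _ "\<lambda>t. t / (p * (p - 1) * (1 - \<rho> * \<sigma>))"])
       (simp only: divide_inverse, simp add: algebra_simps)
  ultimately have "support_plane p \<sigma> \<rho> u x y = u powr (- \<rho>) *
     ((p - 1) * (\<rho> + 1) * (\<rho> + p) - p * \<rho> * (\<rho> + p) * (1 + \<sigma>) * (x / u)
      + \<rho> * (\<rho> + 1) * (p * (1 + \<sigma>) * (x / u) - (p - 1))) / (p * (p - 1) * (1 - \<rho> * \<sigma>))"
    by simp
  also have "(p - 1) * (\<rho> + 1) * (\<rho> + p) - p * \<rho> * (\<rho> + p) * (1 + \<sigma>) * (x / u)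
      + \<rho> * (\<rho> + 1) * (p * (1 + \<sigma>) * (x / u) - (p - 1))
     = (p * (p - 1)) * (\<rho> + 1 - \<rho> * (1 + \<sigma>) * (x / u))"
    by algebra
  finally show ?thesis
    using assms by simp
qed

text \<open>In terms of \<open>a = x / u\<close>, which ranges between \<open>1 / (1 + \<sigma>)\<close> and \<open>1\<close>, the claim is that
  \<open>a powr \<rho> * (\<rho> + 1 - \<rho> * (1 + \<sigma>) * a)\<close> is at least its value \<open>1 - \<rho> * \<sigma>\<close> at \<open>a = 1\<close>;
  it decreases on that range.\<close>

lemma support_plane_lower:
  assumes "1 < p" "0 < \<sigma>" "0 < \<rho>" "\<rho> * \<sigma> < 1" "0 < x" "touching p \<sigma> u x y"
  shows "x powr (- \<rho>) \<le> support_plane p \<sigma> \<rho> u x y"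
proof -
  have u: "x \<le> u" "u \<le> (1 + \<sigma>) * x" "tangent_gap p \<sigma> u x y = 0" "0 < u"
    using assms by (auto simp: touching_def)
  define a where "a = x / u"
  have a: "0 < a" "a \<le> 1" "1 \<le> (1 + \<sigma>) * a"
    using u assms by (auto simp: a_def field_simps)
  define g where "g t = (\<rho> + 1) * t powr \<rho> - \<rho> * (1 + \<sigma>) * t powr (\<rho> + 1)" for t
  have "g 1 \<le> g a"
  proof (rule DERIV_nonpos_imp_nonincreasing[OF a(2)])
    fix t assume t: "a \<le> t" "t \<le> 1"
    then have t0: "0 < t" using a by simp
    have "(g has_real_derivative
        (\<rho> + 1) * (\<rho> * t powr (\<rho> - 1)) - \<rho> * (1 + \<sigma>) * ((\<rho> + 1) * t powr \<rho>)) (at t)"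
      unfolding g_def[abs_def] using t0 by (auto intro!: derivative_eq_intros)
    moreover have "(\<rho> + 1) * (\<rho> * t powr (\<rho> - 1)) - \<rho> * (1 + \<sigma>) * ((\<rho> + 1) * t powr \<rho>)
        = (\<rho> + 1) * \<rho> * t powr (\<rho> - 1) * (1 - (1 + \<sigma>) * t)"
      unfolding powr_minus_one_mult[OF t0, of \<rho>, symmetric] by (simp add: algebra_simps)
    moreover have "(1 + \<sigma>) * a \<le> (1 + \<sigma>) * t"
      using t assms by (intro mult_left_mono) auto
    then have "1 - (1 + \<sigma>) * t \<le> 0" using a by linarith
    then have "(\<rho> + 1) * \<rho> * t powr (\<rho> - 1) * (1 - (1 + \<sigma>) * t) \<le> 0"
      using assms by (intro mult_nonneg_nonpos) auto
    ultimately show "\<exists>D. (g has_real_derivative D) (at t) \<and> D \<le> 0" by metis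
  qed
  moreover have "g a = a powr \<rho> * (\<rho> + 1 - \<rho> * (1 + \<sigma>) * a)"
    using a by (simp add: g_def powr_add algebra_simps)
  ultimately have "1 - \<rho> * \<sigma> \<le> a powr \<rho> * (\<rho> + 1 - \<rho> * (1 + \<sigma>) * a)"
    by (simp add: g_def algebra_simps)
  then have "1 \<le> a powr \<rho> * ((\<rho> + 1 - \<rho> * (1 + \<sigma>) * a) / (1 - \<rho> * \<sigma>))"
    using assms by (simp add: field_simps)
  then have "a powr (- \<rho>) \<le> (\<rho> + 1 - \<rho> * (1 + \<sigma>) * a) / (1 - \<rho> * \<sigma>)"
    using a by (simp add: powr_minus field_simps)
  then have "u powr (- \<rho>) * a powr (- \<rho>) \<le> u powr (- \<rho>) * ((\<rho> + 1 - \<rho> * (1 + \<sigma>) * a) / (1 - \<rho> * \<sigma>))"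
    by (intro mult_left_mono) auto
  moreover have "u powr (- \<rho>) * a powr (- \<rho>) = x powr (- \<rho>)"
    using u a by (simp add: powr_mult[symmetric] a_def)
  ultimately show ?thesis
    using support_plane_on_tangent[of p u \<rho> \<sigma> x y] assms u by (simp add: a_def)
qed

text \<open>Along the segment of the tangent between the two boundaries, the plane is largest at the
  upper boundary, where it equals \<open>u powr (- \<rho>) / (1 - \<rho> * \<sigma>)\<close>, and \<open>y\<close> is largest at the lower
  boundary, where it equals \<open>u powr p\<close>.\<close>

lemma support_plane_upper:
  assumes "1 < p" "0 < \<sigma>" "0 < \<rho>" "\<rho> * \<sigma> < 1" "in_domain p \<sigma> x y" "touching p \<sigma> u x y"
  shows "support_plane p \<sigma> \<rho> u x y \<le> y powr (- \<rho> / p) / (1 - \<rho> * \<sigma>)"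
proof -
  have x: "0 < x" "x powr p \<le> y" "0 < y"
    using assms by (auto simp: in_domain_def intro: less_le_trans[of 0 "x powr p"])
  have u: "x \<le> u" "u \<le> (1 + \<sigma>) * x" "tangent_gap p \<sigma> u x y = 0" "0 < u"
    using assms x by (auto simp: touching_def)
  have "u powr (p - 1) * x \<le> u powr (p - 1) * u"
    using u by (intro mult_left_mono) auto
  then have "u powr (p - 1) * x \<le> u powr p"
    using u powr_minus_one_mult[of u p] by simp
  then have "p * (1 + \<sigma>) * (u powr (p - 1) * x) \<le> p * (1 + \<sigma>) * u powr p"
    using assms by (intro mult_left_mono) auto
  then have "(1 + p * \<sigma>) * y \<le> (1 + p * \<sigma>) * u powr p"
    using u(3) by (simp add: tangent_gap_def algebra_simps)
  then have "y \<le> u powr p"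
    using assms by (simp add: mult_le_cancel_left_pos add_pos_pos)
  then have "(u powr p) powr (- \<rho> / p) \<le> y powr (- \<rho> / p)"
    using x assms by (intro powr_mono2') auto
  then have 1: "u powr (- \<rho>) \<le> y powr (- \<rho> / p)"
    using assms by (simp add: powr_powr)
  have "1 \<le> (1 + \<sigma>) * (x / u)" using u by (simp add: field_simps)
  then have "\<rho> * 1 \<le> \<rho> * ((1 + \<sigma>) * (x / u))"
    using assms by (intro mult_left_mono) auto
  then have "\<rho> + 1 - \<rho> * (1 + \<sigma>) * (x / u) \<le> 1" by (simp add: mult.assoc)
  then have "u powr (- \<rho>) * (\<rho> + 1 - \<rho> * (1 + \<sigma>) * (x / u)) \<le> u powr (- \<rho>) * 1"
    by (intro mult_left_mono) auto
  then have "u powr (- \<rho>) * (\<rho> + 1 - \<rho> * (1 + \<sigma>) * (x / u)) \<le> y powr (- \<rho> / p)"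
    using 1 by simp
  then show ?thesis
    using assms by (subst support_plane_on_tangent) (auto simp: u intro!: divide_right_mono)
qed

text \<open>As a function of \<open>u\<close> the gap has a single minimum, at \<open>u = (1 + \<sigma>) * x\<close>.\<close>

lemma tangent_gap_antimono:
  assumes "1 < p" "0 < a" "a \<le> b" "b \<le> (1 + \<sigma>) * x"
  shows "tangent_gap p \<sigma> b x y \<le> tangent_gap p \<sigma> a x y"
proof (rule DERIV_nonpos_imp_nonincreasing[OF assms(3)])
  fix t assume t: "a \<le> t" "t \<le> b"
  have "p * (p - 1) * t powr (p - 2) * (t - (1 + \<sigma>) * x) \<le> 0"
    using assms t by (intro mult_nonneg_nonpos) auto
  then show "\<exists>D. ((\<lambda>u. tangent_gap p \<sigma> u x y) has_real_derivative D) (at t) \<and> D \<le> 0"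
    using tangent_gap_deriv[of t p \<sigma> x y] t assms by force
qed

lemma tangent_gap_mono:
  assumes "1 < p" "0 < a" "a \<le> b" "(1 + \<sigma>) * x \<le> a"
  shows "tangent_gap p \<sigma> a x y \<le> tangent_gap p \<sigma> b x y"
proof (rule DERIV_nonneg_imp_nondecreasing[OF assms(3)])
  fix t assume t: "a \<le> t" "t \<le> b"
  have "0 \<le> p * (p - 1) * t powr (p - 2) * (t - (1 + \<sigma>) * x)"
    using assms t by (intro mult_nonneg_nonneg) auto
  then show "\<exists>D. ((\<lambda>u. tangent_gap p \<sigma> u x y) has_real_derivative D) (at t) \<and> 0 \<le> D"
    using tangent_gap_deriv[of t p \<sigma> x y] t assms by force
qed

text \<open>The plane belonging to a point \<open>x\<close> lies above the Bellman function at every point \<open>y\<close> visible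
  from \<open>x\<close>, that is, such that the segment from \<open>y\<close> to \<open>x\<close> stays below the upper boundary. As \<open>u\<close>
  varies, the plane at \<open>y\<close> decreases up to the parameter \<open>a\<close> of \<open>y\<close> and increases from there until \<open>y\<close> gets above the
  tangent again. Visibility excludes the latter for the tangent through \<open>x\<close>: if \<open>y\<close> were above it
  and to the left of its contact point, then the segment would run above the tangent, hence
  above the boundary, over the contact point. The strict inequality at \<open>x\<close> keeps \<open>x\<close> itself
  from being the contact point.\<close>

lemma support_plane_le_if_visible:
  assumes p: "1 < p" "0 < \<sigma>" "0 < \<rho>" "\<rho> * \<sigma> < 1"
    and x: "0 < x1" "touching p \<sigma> u x1 x2" "(1 + p * \<sigma>) * x2 < (1 + \<sigma>) powr p * x1 powr p"
    and y: "0 < y1" "touching p \<sigma> a y1 y2"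
    and visible: "\<And>t. 0 \<le> t \<Longrightarrow> t \<le> 1 \<Longrightarrow> (1 + p * \<sigma>) * ((1 - t) * y2 + t * x2)
      \<le> (1 + \<sigma>) powr p * ((1 - t) * y1 + t * x1) powr p"
  shows "support_plane p \<sigma> \<rho> a y1 y2 \<le> support_plane p \<sigma> \<rho> u y1 y2"
proof -
  have u: "x1 \<le> u" "u \<le> (1 + \<sigma>) * x1" "tangent_gap p \<sigma> u x1 x2 = 0" "0 < u"
    using x by (auto simp: touching_def)
  have a: "y1 \<le> a" "a \<le> (1 + \<sigma>) * y1" "tangent_gap p \<sigma> a y1 y2 = 0" "0 < a"
    using y by (auto simp: touching_def)
  have contact: "u < (1 + \<sigma>) * x1"
    using u x(1,3) p tangent_gap_at_contact[of x1 \<sigma> p x2] by (cases "u = (1 + \<sigma>) * x1") auto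
  define c where "c = \<rho> * (\<rho> + 1) * (\<rho> + p) / (p * (p - 1) * (1 - \<rho> * \<sigma>))"
  have c: "0 \<le> c" unfolding c_def using p by auto
  have der: "((\<lambda>u. support_plane p \<sigma> \<rho> u y1 y2) has_real_derivative
      - c * t powr (- \<rho> - p - 1) * tangent_gap p \<sigma> t y1 y2) (at t)" if "0 < t" for t
    using support_plane_deriv[OF that] by (simp add: c_def)
  show ?thesis
  proof (cases "u \<le> a")
    case True
    show ?thesis
    proof (rule DERIV_nonpos_imp_nonincreasing[OF True])
      fix t assume t: "u \<le> t" "t \<le> a"
      have "0 \<le> tangent_gap p \<sigma> t y1 y2"
        using tangent_gap_antimono[of p t a \<sigma> y1 y2] a u t p by auto
      then have "- c * t powr (- \<rho> - p - 1) * tangent_gap p \<sigma> t y1 y2 \<le> 0"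
        using c by (intro mult_nonpos_nonneg) auto
      then show "\<exists>D. ((\<lambda>u. support_plane p \<sigma> \<rho> u y1 y2) has_real_derivative D) (at t) \<and> D \<le> 0"
        using der[of t] t u by force
    qed
  next
    case False
    have gap_u: "tangent_gap p \<sigma> u y1 y2 \<le> 0" if far: "(1 + \<sigma>) * y1 < u"
    proof (rule ccontr)
      assume "\<not> ?thesis"
      then have pos: "0 < tangent_gap p \<sigma> u y1 y2" by simp
      \<comment> \<open>\<open>z\<close> is the abscissa of the contact point of the tangent through \<open>x\<close>.\<close>
      define z where "z = u / (1 + \<sigma>)"
      have z: "y1 < z" "z < x1" "u = (1 + \<sigma>) * z" "0 < z"
        using far u contact p y by (auto simp: z_def field_simps)
      define t where "t = (z - y1) / (x1 - y1)"
      have t: "0 \<le> t" "t < 1" using z by (auto simp: t_def field_simps)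
      have zt: "(1 - t) * y1 + t * x1 = z"
      proof -
        have "t * (x1 - y1) = z - y1" using z by (simp add: t_def)
        then show ?thesis by (simp add: algebra_simps)
      qed
      have "tangent_gap p \<sigma> u z ((1 - t) * y2 + t * x2)
          = (1 - t) * tangent_gap p \<sigma> u y1 y2 + t * tangent_gap p \<sigma> u x1 x2"
        unfolding zt[symmetric] tangent_gap_def by algebra
      moreover have "tangent_gap p \<sigma> u z ((1 - t) * y2 + t * x2)
          = (1 + p * \<sigma>) * ((1 - t) * y2 + t * x2) - (1 + \<sigma>) powr p * z powr p"
        unfolding z(3) using z p by (intro tangent_gap_at_contact) auto
      moreover have "\<dots> \<le> 0"
        using visible[of t] t by (simp add: zt)
      ultimately have "(1 - t) * tangent_gap p \<sigma> u y1 y2 \<le> 0"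
        using u by simp
      then show False using pos t by (simp add: mult_le_0_iff)
    qed
    have "a \<le> u" using False by simp
    then show ?thesis
    proof (rule DERIV_nonneg_imp_nondecreasing)
      fix t assume t: "a \<le> t" "t \<le> u"
      have "tangent_gap p \<sigma> t y1 y2 \<le> 0"
      proof (cases "t \<le> (1 + \<sigma>) * y1")
        case True
        then show ?thesis
          using tangent_gap_antimono[of p a t \<sigma> y1 y2] a t p by auto
      next
        case False
        then show ?thesis
          using tangent_gap_mono[of p t u \<sigma> y1 y2] gap_u t a p by auto
      qed
      then have "0 \<le> - c * t powr (- \<rho> - p - 1) * tangent_gap p \<sigma> t y1 y2"
        using c by (intro mult_nonpos_nonpos) auto
      then show "\<exists>D. ((\<lambda>u. support_plane p \<sigma> \<rho> u y1 y2) has_real_derivative D) (at t) \<and> 0 \<le> D"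
        using der[of t] t a by force
    qed
  qed
qed

lemma bellman_touching:
  assumes "1 < p" "0 < \<sigma>" "in_domain p \<sigma> x y"
  obtains u where "touching p \<sigma> u x y"
    "bellman p \<sigma> \<rho> x y = support_plane p \<sigma> \<rho> u x y"
  using someI_ex[OF touching_exists[OF assms]] by (auto simp: bellman_def)

lemma bellman_lower:
  assumes "1 < p" "0 < \<sigma>" "0 < \<rho>" "\<rho> * \<sigma> < 1" "in_domain p \<sigma> x y"
  shows "x powr (- \<rho>) \<le> bellman p \<sigma> \<rho> x y"
  using assms bellman_touching[of p \<sigma> x y \<rho>] support_plane_lower[of p \<sigma> \<rho> x _ y]
  by (metis in_domain_def)

lemma bellman_upper:
  assumes "1 < p" "0 < \<sigma>" "0 < \<rho>" "\<rho> * \<sigma> < 1" "in_domain p \<sigma> x y"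
  shows "bellman p \<sigma> \<rho> x y \<le> y powr (- \<rho> / p) / (1 - \<rho> * \<sigma>)"
  using assms bellman_touching[of p \<sigma> x y \<rho>] support_plane_upper[of p \<sigma> \<rho> x y]
  by metis

text \<open>The support plane at the midpoint is affine, equals the Bellman function there, and lies above
  it at both ends, since these are visible from the midpoint.\<close>

lemma bellman_midpoint_concave:
  assumes p: "1 < p" "0 < \<sigma>" "0 < \<rho>" "\<rho> * \<sigma> < 1"
    and mid: "x = (x1 + x2) / 2" "y = (y1 + y2) / 2"
    and dom: "in_domain p \<sigma> x y" "in_domain p \<sigma> x1 y1" "in_domain p \<sigma> x2 y2"
    and strict: "(1 + p * \<sigma>) * y < (1 + \<sigma>) powr p * x powr p"
    and vis1: "\<And>t. 0 \<le> t \<Longrightarrow> t \<le> 1 \<Longrightarrow> (1 + p * \<sigma>) * ((1 - t) * y1 + t * y)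
      \<le> (1 + \<sigma>) powr p * ((1 - t) * x1 + t * x) powr p"
    and vis2: "\<And>t. 0 \<le> t \<Longrightarrow> t \<le> 1 \<Longrightarrow> (1 + p * \<sigma>) * ((1 - t) * y2 + t * y)
      \<le> (1 + \<sigma>) powr p * ((1 - t) * x2 + t * x) powr p"
  shows "(bellman p \<sigma> \<rho> x1 y1 + bellman p \<sigma> \<rho> x2 y2) / 2 \<le> bellman p \<sigma> \<rho> x y"
proof -
  obtain u where u: "touching p \<sigma> u x y" "bellman p \<sigma> \<rho> x y = support_plane p \<sigma> \<rho> u x y"
    using bellman_touching[OF p(1,2) dom(1)] by metis
  have le: "bellman p \<sigma> \<rho> x' y' \<le> support_plane p \<sigma> \<rho> u x' y'"
    if d: "in_domain p \<sigma> x' y'" and v: "\<And>t. 0 \<le> t \<Longrightarrow> t \<le> 1 \<Longrightarrow>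
      (1 + p * \<sigma>) * ((1 - t) * y' + t * y) \<le> (1 + \<sigma>) powr p * ((1 - t) * x' + t * x) powr p"
    for x' y'
  proof -
    obtain a where a: "touching p \<sigma> a x' y'"
        "bellman p \<sigma> \<rho> x' y' = support_plane p \<sigma> \<rho> a x' y'"
      using bellman_touching[OF p(1,2) d] by metis
    show ?thesis
      unfolding a(2) using d v dom(1) strict u(1) a(1) p
      by (intro support_plane_le_if_visible[of p \<sigma> \<rho> x u y]) (auto simp: in_domain_def)
  qed
  have "support_plane p \<sigma> \<rho> u x y = (support_plane p \<sigma> \<rho> u x1 y1 + support_plane p \<sigma> \<rho> u x2 y2) / 2"
  proof -
    have "(a - b * ((x1 + x2) / 2) * v + c * ((y1 + y2) / 2) * v') / d
        = ((a - b * x1 * v + c * y1 * v') / d + (a - b * x2 * v + c * y2 * v') / d) / 2"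
      for a b c d v v' :: real
      by (cases "d = 0") (simp_all add: field_simps)
    then show ?thesis unfolding support_plane_def mid .
  qed
  then show ?thesis
    using le[OF dom(2) vis1] le[OF dom(3) vis2] u(2) by simp
qed

section \<open>Dyadic intervals and averages\<close>

definition dyadic :: "int \<Rightarrow> int \<Rightarrow> real set" where
  "dyadic n k = {real_of_int n * 2 powi (-k) .. (real_of_int n + 1) * 2 powi (-k)}"

lemma dyadic_intervals_iff: "I \<in> dyadic_intervals \<longleftrightarrow> (\<exists>n k. I = dyadic n k)"
  by (auto simp: dyadic_intervals_def dyadic_def)

lemma powi_level_Suc: "2 powi (- k) = 2 * (2::real) powi (- (k + 1))"
  using power_int_add[of "2::real" 1 "- (k + 1)"] by simp

lemma dyadic_halves: "dyadic n k = dyadic (2 * n) (k + 1) \<union> dyadic (2 * n + 1) (k + 1)"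
proof -
  define h :: real where "h = 2 powi (- (k + 1))"
  have h: "0 < h" by (simp add: h_def)
  show ?thesis
    unfolding dyadic_def powi_level_Suc[of k] h_def[symmetric] using h
    by (auto simp: algebra_simps)
qed

text \<open>A dyadic interval \<open>L\<close> strictly containing a half of \<open>dyadic n k\<close> has a length that is an
  integer multiple of the length of \<open>dyadic n k\<close>. Its end points therefore lie on the grid of
  level \<open>k\<close>, and \<open>L\<close> contains the other half as well.\<close>

lemma dyadic_parent_child:
  assumes "i \<in> {0, 1}"
  shows "dyadic_parent (dyadic (2 * n + i) (k + 1)) = dyadic n k"
  unfolding dyadic_parent_def
proof (rule Least_equality)
  define h :: real where "h = 2 powi (- (k + 1))"
  have h: "0 < h" by (simp add: h_def)
  have sub: "dyadic (2 * n + i) (k + 1) \<subseteq> dyadic n k"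
    using assms by (auto simp: dyadic_halves[of n k])
  have "dyadic (2 * n + i) (k + 1) \<noteq> dyadic n k"
    unfolding dyadic_def powi_level_Suc[of k] h_def[symmetric] using h
    by (auto simp: Icc_eq_Icc algebra_simps)
  then show "dyadic n k \<in> dyadic_intervals \<and> dyadic (2 * n + i) (k + 1) \<subset> dyadic n k"
    using sub by (auto simp: dyadic_intervals_iff)
  fix L assume L: "L \<in> dyadic_intervals \<and> dyadic (2 * n + i) (k + 1) \<subset> L"
  then obtain m l where m: "L = dyadic m l" by (auto simp: dyadic_intervals_iff)
  define a where "a = 2 * n + i"
  define t :: real where "t = 2 powi (- l)"
  have t: "0 < t" by (simp add: t_def)
  have I: "dyadic a (k + 1) = {a * h .. (a + 1) * h}" "L = {m * t .. (m + 1) * t}"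
    by (simp_all add: dyadic_def h_def t_def m)
  have "a * h \<le> (a + 1) * h" using h by simp
  then have le: "m * t \<le> a * h" "(a + 1) * h \<le> (m + 1) * t"
    using L h unfolding a_def[symmetric] I by (auto simp: psubset_eq)
  have "h < t"
  proof (rule ccontr)
    assume "\<not> h < t"
    then have "m * t = a * h" "(a + 1) * h = (m + 1) * t"
      using le by (auto simp: algebra_simps)
    then show False
      using L unfolding a_def[symmetric] I by auto
  qed
  then have "l < k + 1"
    unfolding h_def t_def
    using power_int_increasing[of "- l" "- (k + 1)" "2::real"] by (cases "l < k + 1") auto
  define M :: int where "M = 2 ^ nat (k - l)"
  have "(2::real) powi (k - l) = 2 ^ nat (k - l)"
    using \<open>l < k + 1\<close> by (simp add: power_int_def)
  moreover have "t = 2 powi (k - l) * 2 powi (- k)"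
    unfolding t_def by (simp add: power_int_add[symmetric])
  ultimately have tM: "t = 2 * M * h"
    unfolding powi_level_Suc[of k] h_def by (simp add: M_def)
  have "real_of_int (2 * (m * M)) * h \<le> real_of_int a * h"
       "real_of_int (a + 1) * h \<le> real_of_int (2 * ((m + 1) * M)) * h"
    using le by (simp_all add: tM algebra_simps)
  then have "2 * (m * M) \<le> a" "a + 1 \<le> 2 * ((m + 1) * M)"
    using h by (simp_all only: mult_le_cancel_right_pos of_int_le_iff)
  then have int: "m * M \<le> n" "n + 1 \<le> (m + 1) * M"
    using assms by (auto simp: a_def)
  then have "real_of_int (m * M) * (2 * h) \<le> real_of_int n * (2 * h)"
    "real_of_int (n + 1) * (2 * h) \<le> real_of_int ((m + 1) * M) * (2 * h)"
    using h by (simp_all only: mult_le_cancel_right_pos of_int_le_iff)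
  then show "dyadic n k \<subseteq> L"
    unfolding I unfolding dyadic_def powi_level_Suc[of k] h_def[symmetric]
    by (auto simp: tM algebra_simps)
qed

lemma dyadic_ends: "real_of_int n * 2 powi (-k) < (real_of_int n + 1) * 2 powi (-k)"
  by (simp add: algebra_simps)

lemma dyadic_length: "(real_of_int n + 1) * 2 powi (-k) - real_of_int n * 2 powi (-k) = 2 powi (-k)"
  by (simp add: algebra_simps)

lemma emeasure_dyadic: "emeasure lebesgue (dyadic n k) = ennreal (2 powi (-k))"
  unfolding dyadic_def using dyadic_ends[of n k]
  by (simp add: emeasure_lborel_Icc_eq dyadic_length)

lemma compact_dyadic: "compact (dyadic n k)" and sets_dyadic [measurable]: "dyadic n k \<in> sets lebesgue"
  by (auto simp: dyadic_def)

lemma dyadic_children_subset: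
  "dyadic n k \<subseteq> J \<Longrightarrow> dyadic (2 * n) (k + 1) \<subseteq> J"
  "dyadic n k \<subseteq> J \<Longrightarrow> dyadic (2 * n + 1) (k + 1) \<subseteq> J"
  using dyadic_halves[of n k] by auto

lemma set_nn_integral_eq_ennreal_integral:
  fixes f :: "real \<Rightarrow> real"
  assumes "f absolutely_integrable_on S" "AE x in lebesgue. 0 \<le> f x"
  shows "(\<integral>\<^sup>+x\<in>S. ennreal (f x) \<partial>lebesgue) = ennreal (integral S f)"
proof -
  have "(\<integral>\<^sup>+x\<in>S. ennreal (f x) \<partial>lebesgue) = (\<integral>\<^sup>+x. ennreal (indicator S x *\<^sub>R f x) \<partial>lebesgue)"
    by (intro nn_integral_cong) (auto simp: indicator_def)
  also have "\<dots> = ennreal (\<integral>x. indicator S x *\<^sub>R f x \<partial>lebesgue)"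
    using assms by (intro nn_integral_eq_integral) (auto simp: set_integrable_def indicator_def)
  also have "(\<integral>x. indicator S x *\<^sub>R f x \<partial>lebesgue) = integral S f"
    using set_lebesgue_integral_eq_integral(2)[OF assms(1)] by (simp add: set_lebesgue_integral_def)
  finally show ?thesis .
qed

lemma integral_nonneg_if_AE_nonneg:
  fixes f :: "real \<Rightarrow> real"
  assumes "f absolutely_integrable_on S" "AE x in lebesgue. 0 \<le> f x"
  shows "0 \<le> integral S f"
proof -
  have "0 \<le> (\<integral>x. indicator S x *\<^sub>R f x \<partial>lebesgue)"
    using assms(2) by (intro integral_nonneg_AE) (auto simp: indicator_def)
  then show ?thesis
    using set_lebesgue_integral_eq_integral(2)[OF assms(1)]
    by (simp add: set_lebesgue_integral_def)
qed

definition dyadic_avg :: "(real \<Rightarrow> real) \<Rightarrow> int \<Rightarrow> int \<Rightarrow> real" where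
  "dyadic_avg f n k = integral (dyadic n k) f * 2 powi k"

lemma avg_dyadic:
  assumes "f absolutely_integrable_on dyadic n k" "AE x in lebesgue. 0 \<le> f x"
  shows "avg f (dyadic n k) = ennreal (dyadic_avg f n k)"
  unfolding avg_def dyadic_avg_def set_nn_integral_eq_ennreal_integral[OF assms] emeasure_dyadic
  using integral_nonneg_if_AE_nonneg[OF assms]
  by (simp add: divide_ennreal power_int_minus field_simps)

lemma integral_dyadic_halves:
  fixes f :: "real \<Rightarrow> real"
  assumes "f integrable_on dyadic n k"
  shows "integral (dyadic n k) f = integral (dyadic (2 * n) (k + 1)) f + integral (dyadic (2 * n + 1) (k + 1)) f"
proof -
  define h :: real where "h = 2 powi (- (k + 1))"
  have h: "0 < h" by (simp add: h_def)
  have "integral {2 * n * h .. (2 * n + 1) * h} f + integral {(2 * n + 1) * h .. (2 * n + 2) * h} f = integral {2 * n * h .. (2 * n + 2) * h} f"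
  proof (rule Henstock_Kurzweil_Integration.integral_combine)
    show "f integrable_on {2 * n * h .. (2 * n + 2) * h}"
      using assms unfolding dyadic_def powi_level_Suc[of k] h_def[symmetric]
      by (simp add: algebra_simps)
  qed (use h in \<open>auto simp: algebra_simps\<close>)
  then show ?thesis
    unfolding dyadic_def powi_level_Suc[of k] h_def[symmetric]
    by (simp add: algebra_simps)
qed

lemma dyadic_avg_halves:
  assumes "f integrable_on dyadic n k"
  shows "dyadic_avg f n k = (dyadic_avg f (2 * n) (k + 1) + dyadic_avg f (2 * n + 1) (k + 1)) / 2"
  unfolding dyadic_avg_def integral_dyadic_halves[OF assms]
  by (simp add: power_int_add algebra_simps)

section \<open>Dyadic differentiation and Bellman induction\<close>

lemma mem_dyadic_floor: "x \<in> dyadic \<lfloor>x * 2 powi k\<rfloor> k"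
proof -
  have p: "(2::real) powi k * 2 powi (- k) = 1" by (simp add: power_int_minus)
  have "real_of_int \<lfloor>x * 2 powi k\<rfloor> * 2 powi (- k) \<le> (x * 2 powi k) * 2 powi (- k)"
    by (intro mult_right_mono) auto
  moreover have "(x * 2 powi k) * 2 powi (- k) \<le> (real_of_int \<lfloor>x * 2 powi k\<rfloor> + 1) * 2 powi (- k)"
    by (intro mult_right_mono) (auto intro: less_imp_le real_of_int_floor_add_one_gt)
  ultimately show ?thesis
    using p by (simp add: dyadic_def mult.assoc)
qed

lemma dyadic_interior_bounds:
  assumes "x \<in> dyadic n k" "x \<noteq> (real_of_int n + 1) * 2 powi (- k)"
  shows "real_of_int n \<le> x * 2 powi k" "x * 2 powi k < real_of_int n + 1"
proof -
  have "real_of_int n * 2 powi (- k) \<le> x" "x < (real_of_int n + 1) * 2 powi (- k)"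
    using assms by (auto simp: dyadic_def)
  then show "real_of_int n \<le> x * 2 powi k" "x * 2 powi k < real_of_int n + 1"
    by (auto simp: power_int_minus field_simps)
qed

lemma AE_not_dyadic_end: "AE x in lebesgue. x \<noteq> (real_of_int n + 1) * 2 powi (- k)"
  by (intro AE_I'[of "{(real_of_int n + 1) * 2 powi (- k)}"])
    (auto simp: negligible_iff_null_sets[symmetric])

lemma dyadic_floor_subset:
  assumes "x \<in> dyadic n k" "x \<noteq> (real_of_int n + 1) * 2 powi (- k)"
  shows "dyadic \<lfloor>x * 2 powi (k + int j)\<rfloor> (k + int j) \<subseteq> dyadic n k"
proof -
  define h :: real where "h = 2 powi (- (k + int j))"
  define m where "m = \<lfloor>x * 2 powi (k + int j)\<rfloor>"
  have h: "0 < h" by (simp add: h_def)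
  have scale: "x * 2 powi (k + int j) = (x * 2 powi k) * 2 ^ j"
    by (simp add: power_int_add)
  note b = dyadic_interior_bounds[OF assms]
  have "real_of_int (n * 2 ^ j) \<le> x * 2 powi (k + int j)"
    unfolding scale using b(1) by simp
  moreover have "x * 2 powi (k + int j) < real_of_int ((n + 1) * 2 ^ j)"
    unfolding scale using b(2) by simp
  ultimately have "n * 2 ^ j \<le> m" "m + 1 \<le> (n + 1) * 2 ^ j"
    unfolding m_def by linarith+
  then have "real_of_int (n * 2 ^ j) * h \<le> real_of_int m * h"
    "real_of_int (m + 1) * h \<le> real_of_int ((n + 1) * 2 ^ j) * h"
    using h by (simp_all only: mult_le_cancel_right_pos of_int_le_iff)
  moreover have "2 powi (- k) = 2 ^ j * h"
    unfolding h_def by (simp add: power_int_diff)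
  ultimately show ?thesis
    unfolding m_def[symmetric] dyadic_def h_def[symmetric] by auto
qed

text \<open>Lebesgue differentiation for the intervals \<open>[x, x + h]\<close>, applied to \<open>w\<close> and to its reflection.\<close>

lemma one_sided_averages_converge:
  fixes w :: "real \<Rightarrow> real"
  assumes w: "\<And>a b. w integrable_on {a..b}"
  obtains N where "negligible N"
    "\<And>x e. x \<notin> N \<Longrightarrow> 0 < e \<Longrightarrow> \<exists>d>0. \<forall>h. 0 < h \<and> h < d \<longrightarrow>
       \<bar>integral {x..x + h} w - h * w x\<bar> \<le> e * h \<and> \<bar>integral {x - h..x} w - h * w x\<bar> \<le> e * h"
proof -
  obtain N1 where N1: "negligible N1" "\<And>x e. x \<notin> N1 \<Longrightarrow> 0 < e \<Longrightarrow> \<exists>d>0. \<forall>h. 0 < h \<and> h < d \<longrightarrow>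
      norm (integral {x..x + h} w /\<^sub>R h - w x) < e"
    using integrable_ccontinuous_explicit[of w] w by (auto simp: cbox_interval)
  have "(\<lambda>t. w (- t)) integrable_on {a..b}" for a b
    using w[of "-b" "-a"] Henstock_Kurzweil_Integration.integrable_reflect_real[where f = w and a = "-b" and b = "-a"] by simp
  then obtain N2 where N2: "negligible N2" "\<And>x e. x \<notin> N2 \<Longrightarrow> 0 < e \<Longrightarrow> \<exists>d>0. \<forall>h. 0 < h \<and> h < d \<longrightarrow>
      norm (integral {x..x + h} (\<lambda>t. w (- t)) /\<^sub>R h - w (- x)) < e"
    using integrable_ccontinuous_explicit[of "\<lambda>t. w (- t)"] by (auto simp: cbox_interval)
  have scale: "\<bar>I - h * c\<bar> \<le> e * h" if "norm (I /\<^sub>R h - c) < e" "0 < h" for I h c e :: real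
  proof -
    have "I - h * c = h * (I /\<^sub>R h - c)" using that by (simp add: field_simps)
    then have "\<bar>I - h * c\<bar> = h * norm (I /\<^sub>R h - c)" using that by (simp add: abs_mult)
    also have "\<dots> \<le> h * e" using that by (intro mult_left_mono) auto
    finally show ?thesis by (simp add: mult.commute)
  qed
  have neg: "negligible (N1 \<union> uminus ` N2)"
    using N1(1) N2(1) by (intro negligible_Un negligible_differentiable_image_negligible) auto
  show ?thesis
  proof (rule that[OF neg])
    fix x e :: real assume x: "x \<notin> N1 \<union> uminus ` N2" and e: "0 < e"
    then have "- x \<notin> N2" by force
    obtain d1 where d1: "0 < d1" "\<And>h. 0 < h \<Longrightarrow> h < d1 \<Longrightarrow> norm (integral {x..x + h} w /\<^sub>R h - w x) < e"
      using N1(2)[of x e] x e by auto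
    obtain d2 where d2: "0 < d2" "\<And>h. 0 < h \<Longrightarrow> h < d2 \<Longrightarrow>
        norm (integral {- x..- x + h} (\<lambda>t. w (- t)) /\<^sub>R h - w x) < e"
      using N2(2)[of "- x" e] \<open>- x \<notin> N2\<close> e by auto
    have refl: "integral {- x..- x + h} (\<lambda>t. w (- t)) = integral {x - h..x} w" for h
      using Henstock_Kurzweil_Integration.integral_reflect_real[where f = w and a = "x - h" and b = x] by simp
    show "\<exists>d>0. \<forall>h. 0 < h \<and> h < d \<longrightarrow>
       \<bar>integral {x..x + h} w - h * w x\<bar> \<le> e * h \<and> \<bar>integral {x - h..x} w - h * w x\<bar> \<le> e * h"
      using d1 d2 scale by (intro exI[of _ "min d1 d2"]) (auto simp: refl[symmetric])
  qed
qed

text \<open>The Lebesgue differentiation theorem along the dyadic intervals containing \<open>x\<close>. The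
  point divides such an interval into two one-sided intervals, and the one-sided estimates add up.\<close>

lemma dyadic_averages_converge:
  fixes w :: "real \<Rightarrow> real"
  assumes w: "\<And>a b. w integrable_on {a..b}"
  shows "AE x in lebesgue. (\<lambda>j::nat. dyadic_avg w \<lfloor>x * 2 powi (k + int j)\<rfloor> (k + int j)) \<longlonglongrightarrow> w x"
proof -
  obtain N where N: "negligible N"
    "\<And>x e. x \<notin> N \<Longrightarrow> 0 < e \<Longrightarrow> \<exists>d>0. \<forall>h. 0 < h \<and> h < d \<longrightarrow>
       \<bar>integral {x..x + h} w - h * w x\<bar> \<le> e * h \<and> \<bar>integral {x - h..x} w - h * w x\<bar> \<le> e * h"
    using one_sided_averages_converge[OF w] by metis
  have "(\<lambda>j::nat. dyadic_avg w \<lfloor>x * 2 powi (k + int j)\<rfloor> (k + int j)) \<longlonglongrightarrow> w x" if x: "x \<notin> N" for x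
  proof (rule LIMSEQ_I)
    fix e :: real assume "0 < e"
    obtain d where d: "0 < d" "\<And>h. 0 < h \<Longrightarrow> h < d \<Longrightarrow>
       \<bar>integral {x..x + h} w - h * w x\<bar> \<le> e / 2 * h \<and> \<bar>integral {x - h..x} w - h * w x\<bar> \<le> e / 2 * h"
      using N(2)[OF x, of "e / 2"] \<open>0 < e\<close> by auto
    have d0: "\<bar>integral {x..x + h} w - h * w x\<bar> \<le> e / 2 * h \<and> \<bar>integral {x - h..x} w - h * w x\<bar> \<le> e / 2 * h"
      if "0 \<le> h" "h < d" for h using d(2)[of h] that by (cases "h = 0") auto
    have "(\<lambda>j::nat. (2::real) powi (- k) * (1 / 2) ^ j) \<longlonglongrightarrow> 2 powi (- k) * 0"
      by (intro tendsto_intros) auto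
    moreover have "(2::real) powi (- k) * (1 / 2) ^ j = 2 powi (- (k + int j))" for j
      by (simp add: power_int_diff power_one_over divide_simps)
    ultimately have "(\<lambda>j::nat. (2::real) powi (- (k + int j))) \<longlonglongrightarrow> 0" by simp
    then have "\<forall>\<^sub>F j in sequentially. (2::real) powi (- (k + int j)) < d"
      using d by (intro order_tendstoD) auto
    then obtain j0 where j0: "\<And>j. j0 \<le> j \<Longrightarrow> (2::real) powi (- (k + int j)) < d"
      by (auto simp: eventually_sequentially)
    show "\<exists>j0. \<forall>j\<ge>j0. norm (dyadic_avg w \<lfloor>x * 2 powi (k + int j)\<rfloor> (k + int j) - w x) < e"
    proof (intro exI[of _ j0] allI impI)
      fix j assume "j0 \<le> j"
      define l where "l = k + int j"
      define h :: real where "h = 2 powi (- l)"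
      define n where "n = \<lfloor>x * 2 powi l\<rfloor>"
      define a where "a = real_of_int n * h"
      have h: "0 < h" "h < d" using j0[OF \<open>j0 \<le> j\<close>] by (auto simp: h_def l_def)
      have D: "dyadic n l = {a..a + h}" by (simp add: dyadic_def a_def h_def algebra_simps)
      have xD: "a \<le> x" "x \<le> a + h"
        using mem_dyadic_floor[of x l] unfolding n_def[symmetric] D by auto
      have "integral {a..a + h} w = integral {a..x} w + integral {x..a + h} w"
        using xD w by (simp add: Henstock_Kurzweil_Integration.integral_combine)
      moreover have "(x - a) * w x + (a + h - x) * w x = h * w x"
          "e / 2 * (x - a) + e / 2 * (a + h - x) = e / 2 * h"
        by (simp_all add: field_simps)
      moreover have "\<bar>integral {a..x} w - (x - a) * w x\<bar> \<le> e / 2 * (x - a)"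
        using d0[of "x - a"] xD h by simp
      moreover have "\<bar>integral {x..a + h} w - (a + h - x) * w x\<bar> \<le> e / 2 * (a + h - x)"
        using d0[of "a + h - x"] xD h by simp
      ultimately have "\<bar>integral {a..a + h} w - h * w x\<bar> \<le> e / 2 * h"
        by linarith
      moreover have "2 powi l = inverse h" by (simp add: h_def power_int_minus)
      then have "dyadic_avg w n l - w x = (integral {a..a + h} w - h * w x) / h"
        using h by (simp add: dyadic_avg_def D field_simps)
      ultimately have "norm (dyadic_avg w n l - w x) \<le> e / 2"
        using h by (simp add: abs_divide pos_divide_le_eq)
      then show "norm (dyadic_avg w \<lfloor>x * 2 powi (k + int j)\<rfloor> (k + int j) - w x) < e"
        using \<open>0 < e\<close> by (simp add: l_def n_def)
    qed
  qed
  then show ?thesis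
    using N(1) by (intro AE_I'[of N]) (auto simp: negligible_iff_null_sets)
qed

lemma dyadic_step_measurable:
  fixes g :: "int \<Rightarrow> 'b::topological_space"
  shows "(\<lambda>x::real. g \<lfloor>x * c\<rfloor>) \<in> borel_measurable lebesgue"
proof -
  have "(\<lambda>x::real. g \<lfloor>x * c\<rfloor>) \<in> borel_measurable borel" by measurable
  then show ?thesis by (intro measurable_completion) simp
qed

text \<open>The Bellman induction: if \<open>g\<close> at an interval dominates the mean of \<open>g\<close> at the two halves,
  it dominates the mean over the descendants of any generation. The sum over the \<open>2 ^ j\<close> descendants
  is expressed as the integral of the step function that evaluates \<open>g\<close> at the descendant
  containing \<open>x\<close>.\<close>

lemma dyadic_supersolution_nn_integral:
  fixes g :: "int \<Rightarrow> int \<Rightarrow> ennreal"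
  assumes g: "\<And>n k. dyadic n k \<subseteq> J \<Longrightarrow> g (2 * n) (k + 1) + g (2 * n + 1) (k + 1) \<le> 2 * g n k"
    and sub: "dyadic n k \<subseteq> J"
  shows "(\<integral>\<^sup>+x\<in>dyadic n k. g \<lfloor>x * 2 powi (k + int j)\<rfloor> (k + int j) \<partial>lebesgue)
           \<le> g n k * ennreal (2 powi (- k))"
  using sub
proof (induction j arbitrary: n k)
  case 0
  have "(\<integral>\<^sup>+x\<in>dyadic n k. g \<lfloor>x * 2 powi k\<rfloor> k \<partial>lebesgue) = (\<integral>\<^sup>+x\<in>dyadic n k. g n k \<partial>lebesgue)"
    \<comment> \<open>At the right end point of \<open>dyadic n k\<close> the floor is \<open>n + 1\<close> instead of \<open>n\<close>.\<close>
  proof (rule nn_integral_cong_AE)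
    show "AE x in lebesgue. g \<lfloor>x * 2 powi k\<rfloor> k * indicator (dyadic n k) x
         = g n k * indicator (dyadic n k) x"
      using AE_not_dyadic_end[of n k]
    proof eventually_elim
      case (elim x)
      show ?case
      proof (cases "x \<in> dyadic n k")
        case True
        then have "\<lfloor>x * 2 powi k\<rfloor> = n"
          using dyadic_interior_bounds[OF True elim] by linarith
        then show ?thesis by simp
      qed simp
    qed
  qed
  then show ?case by (simp add: nn_integral_cmult_indicator emeasure_dyadic)
next
  case (Suc j)
  define G where "G x = g \<lfloor>x * 2 powi (k + int (Suc j))\<rfloor> (k + int (Suc j))" for x :: real
  have shift: "G x = g \<lfloor>x * 2 powi (k + 1 + int j)\<rfloor> (k + 1 + int j)" for x
    by (simp add: G_def algebra_simps)
  let ?L = "dyadic (2 * n) (k + 1)" and ?R = "dyadic (2 * n + 1) (k + 1)"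
  have [measurable]: "G \<in> borel_measurable lebesgue"
    unfolding G_def by (rule dyadic_step_measurable)
  have "(\<integral>\<^sup>+x\<in>dyadic n k. G x \<partial>lebesgue) \<le> (\<integral>\<^sup>+x. G x * indicator ?L x + G x * indicator ?R x \<partial>lebesgue)"
    unfolding dyadic_halves[of n k] by (intro nn_integral_mono) (auto simp: indicator_def)
  also have "\<dots> = (\<integral>\<^sup>+x\<in>?L. G x \<partial>lebesgue) + (\<integral>\<^sup>+x\<in>?R. G x \<partial>lebesgue)"
    by (rule nn_integral_add) measurable
  also have "\<dots> \<le> g (2 * n) (k + 1) * ennreal (2 powi (- (k + 1))) + g (2 * n + 1) (k + 1) * ennreal (2 powi (- (k + 1)))"
    unfolding shift using Suc.prems by (intro add_mono Suc.IH dyadic_children_subset)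
  also have "\<dots> = (g (2 * n) (k + 1) + g (2 * n + 1) (k + 1)) * ennreal (2 powi (- (k + 1)))"
    by (simp add: distrib_right)
  also have "\<dots> \<le> 2 * g n k * ennreal (2 powi (- (k + 1)))"
    using g Suc.prems by (intro mult_right_mono) auto
  also have "\<dots> = g n k * ennreal (2 powi (- k))"
    unfolding powi_level_Suc[of k] by (simp add: ennreal_mult mult_ac)
  finally show ?case by (simp add: G_def)
qed

section \<open>Averages of a weight and of its negative powers\<close>

lemma weight_absolutely_integrable_dyadic:
  "weight w \<Longrightarrow> w absolutely_integrable_on dyadic n k"
  using compact_dyadic by (auto simp: weight_def)

lemma weight_integrable_Icc: "weight w \<Longrightarrow> w integrable_on {a..b}"
  by (auto simp: weight_def intro: set_lebesgue_integral_eq_integral(1))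

lemma weight_AE_nonneg: "weight w \<Longrightarrow> AE x in lebesgue. 0 \<le> w x"
  by (auto simp: weight_def elim: AE_mp)

lemma weight_dyadic_avg_pos:
  assumes w: "weight w"
  shows "0 < dyadic_avg w n k"
proof -
  let ?I = "dyadic n k"
  have "(\<integral>\<^sup>+x\<in>?I. ennreal (w x) \<partial>lebesgue) \<noteq> 0"
  proof
    assume 0: "(\<integral>\<^sup>+x\<in>?I. ennreal (w x) \<partial>lebesgue) = 0"
    have [measurable]: "(\<lambda>x. indicator ?I x * w x) \<in> borel_measurable lebesgue"
      using weight_absolutely_integrable_dyadic[OF w, of n k]
      by (auto simp: set_integrable_def dest: borel_measurable_integrable)
    have eq: "ennreal (w x) * indicator ?I x = ennreal (indicator ?I x * w x)" for x
      by (auto simp: indicator_def)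
    have "AE x in lebesgue. ennreal (indicator ?I x * w x) = 0"
      using 0 unfolding eq by (subst (asm) nn_integral_0_iff_AE) auto
    moreover have "AE x in lebesgue. 0 < w x" using w by (simp add: weight_def)
    ultimately have "AE x in lebesgue. x \<notin> ?I"
      by eventually_elim (auto simp: indicator_def split: if_splits)
    then have "emeasure lebesgue ?I = 0"
      by (subst (asm) AE_iff_measurable[OF sets_dyadic]) auto
    then show False by (simp add: emeasure_dyadic)
  qed
  then have "integral ?I w \<noteq> 0"
    using set_nn_integral_eq_ennreal_integral[OF weight_absolutely_integrable_dyadic[OF w] weight_AE_nonneg[OF w]]
    by auto
  moreover have "0 \<le> integral ?I w"
    using w by (intro integral_nonneg_if_AE_nonneg weight_absolutely_integrable_dyadic weight_AE_nonneg)
  ultimately show ?thesis by (simp add: dyadic_avg_def)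
qed

text \<open>The tangent line of \<open>z powr p\<close> at the average of \<open>w\<close> is integrated.\<close>

lemma dyadic_avg_jensen:
  assumes w: "weight w" and p: "1 < p"
    and wp: "(\<lambda>x. w x powr p) absolutely_integrable_on dyadic n k"
  shows "dyadic_avg w n k powr p \<le> dyadic_avg (\<lambda>x. w x powr p) n k"
proof -
  let ?I = "dyadic n k"
  define m where "m = dyadic_avg w n k"
  have m: "0 < m" using weight_dyadic_avg_pos[OF w] by (simp add: m_def)
  define c where "c = p * m powr (p - 1)"
  have one: "(\<lambda>x::real. a) absolutely_integrable_on ?I" for a :: real
    by (simp add: absolutely_integrable_on_const compact_imp_bounded sets_dyadic emeasure_dyadic fmeasurableI)
  have int: "(\<lambda>x. w x powr p - c * w x + (c * m - m powr p)) absolutely_integrable_on ?I"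
    using wp one weight_absolutely_integrable_dyadic[OF w]
    by (intro set_integral_add set_integral_diff set_integrable_mult_right) auto
  have "0 \<le> integral ?I (\<lambda>x. w x powr p - c * w x + (c * m - m powr p))"
  proof (rule integral_nonneg_if_AE_nonneg[OF int])
    show "AE x in lebesgue. 0 \<le> w x powr p - c * w x + (c * m - m powr p)"
      using weight_AE_nonneg[OF w]
    proof eventually_elim
      case (elim x)
      then show ?case
        using powr_above_tangent(1)[OF p m elim] by (simp add: c_def algebra_simps)
    qed
  qed
  also have "integral ?I (\<lambda>x. w x powr p - c * w x + (c * m - m powr p))
      = integral ?I (\<lambda>x. w x powr p) - c * integral ?I w + integral ?I (\<lambda>x. c * m - m powr p)"
  proof -
    have i: "(\<lambda>x. w x powr p) integrable_on ?I" "(\<lambda>x. c * w x) integrable_on ?I"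
      "(\<lambda>x::real. c * m - m powr p) integrable_on ?I"
      using set_lebesgue_integral_eq_integral(1)[OF wp] set_lebesgue_integral_eq_integral(1)[OF one]
        set_lebesgue_integral_eq_integral(1)[OF weight_absolutely_integrable_dyadic[OF w, of n k]]
      by (auto intro: integrable_on_mult_right)
    then show ?thesis
      by (simp add: Henstock_Kurzweil_Integration.integral_add
          Henstock_Kurzweil_Integration.integral_diff integrable_diff)
  qed
  also have "integral ?I (\<lambda>x. c * m - m powr p) = 2 powi (- k) * (c * m - m powr p)"
    using dyadic_ends[of n k] dyadic_length[of n k] by (simp add: dyadic_def)
  finally have "0 \<le> (integral ?I (\<lambda>x. w x powr p) - c * integral ?I w + 2 powi (- k) * (c * m - m powr p)) * 2 powi k"
    by simp
  also have "\<dots> = dyadic_avg (\<lambda>x. w x powr p) n k - m powr p"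
    by (simp add: dyadic_avg_def m_def algebra_simps power_int_minus)
  finally show ?thesis by (simp add: m_def)
qed

text \<open>The average of \<open>w\<close> is positive and finite, so an infinite average of \<open>w powr p\<close> would make the
  reverse Hoelder constant infinite.\<close>

lemma RH_const_avg_bound:
  assumes w: "weight w" and p: "1 < p" and fin: "RH_const J p w < \<infinity>" and sub: "dyadic n k \<subseteq> J"
  shows "(\<lambda>x. w x powr p) absolutely_integrable_on dyadic n k" (is ?int)
    and "dyadic_avg (\<lambda>x. w x powr p) n k
           \<le> enn2real (RH_const J p w) powr p * dyadic_avg w n k powr p" (is ?bound)
proof -
  let ?I = "dyadic n k"
  define \<delta> where "\<delta> = enn2real (RH_const J p w)"
  define X where "X = dyadic_avg w n k"
  have X: "0 < X" using weight_dyadic_avg_pos[OF w] by (simp add: X_def)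
  define A where "A = avg (\<lambda>x. w x powr p) ?I"
  have "epowr A (1 / p) / avg w ?I \<le> RH_const J p w"
    unfolding RH_const_def A_def using sub
    by (intro SUP_upper) (auto simp: dyadic_in_def dyadic_intervals_iff)
  moreover have "RH_const J p w = ennreal \<delta>"
    using fin by (simp add: \<delta>_def less_top)
  moreover have "avg w ?I = ennreal X"
    unfolding X_def by (intro avg_dyadic weight_absolutely_integrable_dyadic weight_AE_nonneg w)
  ultimately have le: "epowr A (1 / p) / ennreal X \<le> ennreal \<delta>" by simp
  have "A \<noteq> \<infinity>"
  proof
    assume "A = \<infinity>"
    then have "\<infinity> \<le> ennreal \<delta>" using le by (simp add: epowr_def ennreal_top_divide)
    then show False by (simp add: top_unique)
  qed
  then obtain a where a: "0 \<le> a" "A = ennreal a" by (cases A) auto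
  have "ennreal (a powr (1 / p) / X) \<le> ennreal \<delta>"
    using le a X by (simp add: epowr_def divide_ennreal)
  then have "a powr (1 / p) \<le> \<delta> * X"
    using X by (simp add: \<delta>_def pos_divide_le_eq)
  then have "(a powr (1 / p)) powr p \<le> (\<delta> * X) powr p"
    using p by (intro powr_mono2) auto
  then have a_le: "a \<le> \<delta> powr p * X powr p"
    using p a by (simp add: powr_powr powr_mult)
  have "(\<lambda>x. indicator ?I x *\<^sub>R w x) \<in> borel_measurable lebesgue"
    using weight_absolutely_integrable_dyadic[OF w] by (auto simp: set_integrable_def)
  then have "(\<lambda>x. (indicator ?I x *\<^sub>R w x) powr p) \<in> borel_measurable lebesgue"
    by measurable
  moreover have pw: "(indicator ?I x *\<^sub>R w x) powr p = indicator ?I x *\<^sub>R (w x powr p)" for x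
    by (auto simp: indicator_def)
  ultimately have meas: "(\<lambda>x. indicator ?I x *\<^sub>R (w x powr p)) \<in> borel_measurable lebesgue"
    by simp
  have "(\<integral>\<^sup>+x\<in>?I. ennreal (w x powr p) \<partial>lebesgue) \<noteq> \<infinity>"
    using \<open>A \<noteq> \<infinity>\<close> unfolding A_def avg_def emeasure_dyadic
    by (auto simp: ennreal_top_divide)
  moreover have "(\<integral>\<^sup>+x\<in>?I. ennreal (w x powr p) \<partial>lebesgue) = (\<integral>\<^sup>+x. ennreal (norm (indicator ?I x *\<^sub>R (w x powr p))) \<partial>lebesgue)"
    by (intro nn_integral_cong) (auto simp: indicator_def)
  ultimately show int: ?int
    unfolding set_integrable_def using meas by (intro integrableI_bounded) (auto simp: less_top)
  have "A = ennreal (dyadic_avg (\<lambda>x. w x powr p) n k)"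
    unfolding A_def by (intro avg_dyadic int) auto
  moreover have "0 \<le> dyadic_avg (\<lambda>x. w x powr p) n k"
    using integral_nonneg_if_AE_nonneg[OF int] by (simp add: dyadic_avg_def)
  ultimately have "dyadic_avg (\<lambda>x. w x powr p) n k = a" using a by simp
  then show ?bound using a_le by (simp add: \<delta>_def X_def)
qed

lemma Db_avg_bound:
  assumes w: "weight w" and fin: "Db w < \<infinity>" and i: "i \<in> {0, 1}"
  shows "dyadic_avg w n k \<le> enn2real (Db w) * dyadic_avg w (2 * n + i) (k + 1)"
proof -
  have a: "avg w (dyadic m l) = ennreal (dyadic_avg w m l)" for m l
    by (intro avg_dyadic weight_absolutely_integrable_dyadic weight_AE_nonneg w)
  have "avg w (dyadic_parent (dyadic (2 * n + i) (k + 1))) / avg w (dyadic (2 * n + i) (k + 1)) \<le> Db w"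
    unfolding Db_def by (intro SUP_upper) (auto simp: dyadic_intervals_iff)
  moreover have "Db w = ennreal (enn2real (Db w))"
    using fin by (simp add: less_top)
  ultimately have "ennreal (dyadic_avg w n k / dyadic_avg w (2 * n + i) (k + 1)) \<le> ennreal (enn2real (Db w))"
    unfolding dyadic_parent_child[OF i] a
    using weight_dyadic_avg_pos[OF w] by (metis divide_ennreal less_imp_le)
  then show ?thesis
    using weight_dyadic_avg_pos[OF w] by (simp add: pos_divide_le_eq)
qed

text \<open>The points \<open>(X, Y)\<close> formed by the averages of \<open>w\<close> and \<open>w powr p\<close> over an interval lie
  below the curve \<open>D * x powr p\<close>; the point of an interval is the midpoint of those of its
  halves, and by the doubling property the segments joining it to them stay below the curve
  \<open>D * E * x powr p\<close>, which is the upper boundary of the domain of the Bellman function.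
  Hence the Bellman function of these points is a supersolution for the dyadic induction.
  It dominates \<open>X powr (- \<rho>)\<close>; since \<open>X\<close> converges to \<open>w\<close> almost everywhere, Fatou's lemma turns
  the induction into a bound for the average of \<open>w powr (- \<rho>)\<close>.\<close>

lemma avg_neg_powr_le:
  assumes p: "1 < p" "0 < \<sigma>" "0 < \<rho>" "\<rho> * \<sigma> < 1" and Q: "2 \<le> Q" and D: "0 < D"
    and w: "weight w"
    and int: "\<And>n k. dyadic n k \<subseteq> J \<Longrightarrow> (\<lambda>x. w x powr p) absolutely_integrable_on dyadic n k"
    and RH: "\<And>n k. dyadic n k \<subseteq> J \<Longrightarrow>
        dyadic_avg (\<lambda>x. w x powr p) n k \<le> D * dyadic_avg w n k powr p"
    and doubling: "\<And>n k i. i \<in> {0, 1} \<Longrightarrow>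
        dyadic_avg w n k \<le> Q * dyadic_avg w (2 * n + i) (k + 1)"
    and enlarge: "D * chord_factor p ((Q powr p - 1) / (Q - 1)) * (1 + p * \<sigma>) = (1 + \<sigma>) powr p"
    and sub: "dyadic n k \<subseteq> J"
  shows "avg (\<lambda>x. w x powr (- \<rho>)) (dyadic n k)
    \<le> ennreal (dyadic_avg (\<lambda>x. w x powr p) n k powr (- \<rho> / p) / (1 - \<rho> * \<sigma>))"
proof -
  define X where "X n k = dyadic_avg w n k" for n k
  define Y where "Y n k = dyadic_avg (\<lambda>x. w x powr p) n k" for n k
  define E where "E = chord_factor p ((Q powr p - 1) / (Q - 1))"
  have X: "0 < X n k" for n k
    using weight_dyadic_avg_pos[OF w] by (simp add: X_def)
  have H: "p < (Q powr p - 1) / (Q - 1)" using powr_slope_gt p Q by simp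
  have E: "1 < E" unfolding E_def using p(1) H by (rule chord_factor_gt_1)
  have \<sigma>: "0 < 1 + p * \<sigma>" using p by (simp add: add_pos_pos)
  \<comment> \<open>Since \<open>E > 1\<close>, the points are off the upper boundary of the enlarged domain.\<close>
  have strict: "(1 + p * \<sigma>) * Y n k < (1 + \<sigma>) powr p * X n k powr p" if "dyadic n k \<subseteq> J" for n k
  proof -
    have "D * X n k powr p * 1 < D * X n k powr p * E"
      using D X[of n k] E by (intro mult_strict_left_mono) auto
    then have "Y n k < D * E * X n k powr p"
      using RH[OF that] by (simp add: X_def Y_def mult_ac)
    then have "(1 + p * \<sigma>) * Y n k < (1 + p * \<sigma>) * (D * E * X n k powr p)"
      using \<sigma> by (intro mult_strict_left_mono) auto
    also have "\<dots> = (D * E * (1 + p * \<sigma>)) * X n k powr p" by (simp add: mult_ac)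
    finally show ?thesis using enlarge by (simp add: E_def)
  qed
  have dom: "in_domain p \<sigma> (X n k) (Y n k)" if "dyadic n k \<subseteq> J" for n k
    using X[of n k] strict[OF that] dyadic_avg_jensen[OF w p(1) int[OF that]]
    by (simp add: in_domain_def X_def Y_def)
  define g where "g n k = bellman p \<sigma> \<rho> (X n k) (Y n k)" for n k
  have lower: "X n k powr (- \<rho>) \<le> g n k" if "dyadic n k \<subseteq> J" for n k
    unfolding g_def using p dom[OF that] by (intro bellman_lower) auto
  have g_nonneg: "0 \<le> g n k" if "dyadic n k \<subseteq> J" for n k
    using lower[OF that] by (meson order_trans powr_ge_zero)
  have super: "(g (2 * n) (k + 1) + g (2 * n + 1) (k + 1)) / 2 \<le> g n k" if I: "dyadic n k \<subseteq> J" for n k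
  proof -
    note ch = dyadic_children_subset[OF I]
    have midX: "X n k = (X (2 * n) (k + 1) + X (2 * n + 1) (k + 1)) / 2"
      unfolding X_def using w by (intro dyadic_avg_halves set_lebesgue_integral_eq_integral(1) weight_absolutely_integrable_dyadic)
    have midY: "Y n k = (Y (2 * n) (k + 1) + Y (2 * n + 1) (k + 1)) / 2"
      unfolding Y_def by (intro dyadic_avg_halves set_lebesgue_integral_eq_integral(1) int I)
    have vis: "(1 + p * \<sigma>) * ((1 - t) * Y (2 * n + i) (k + 1) + t * Y n k)
        \<le> (1 + \<sigma>) powr p * ((1 - t) * X (2 * n + i) (k + 1) + t * X n k) powr p"
      if i: "i \<in> {0, 1}" and t: "0 \<le> t" "t \<le> 1" for i t
    proof -
      have chi: "dyadic (2 * n + i) (k + 1) \<subseteq> J" using ch i by auto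
      \<comment> \<open>The average over a half is at most twice the average over the interval, hence \<open>Q \<ge> 2\<close>.\<close>
      have "X (2 * n + i) (k + 1) \<le> 2 * X n k"
        using i midX X[of "2 * n" "k + 1"] X[of "2 * n + 1" "k + 1"] by auto
      also have "\<dots> \<le> Q * X n k" using X[of n k] Q by (intro mult_right_mono) auto
      finally have "X (2 * n + i) (k + 1) \<le> Q * X n k" .
      moreover have "X n k \<le> Q * X (2 * n + i) (k + 1)"
        using doubling[OF i] by (simp add: X_def)
      ultimately have "(1 - t) * Y (2 * n + i) (k + 1) + t * Y n k
          \<le> D * E * ((1 - t) * X (2 * n + i) (k + 1) + t * X n k) powr p"
        unfolding E_def using p Q D X RH[OF I] RH[OF chi] t
        by (intro segment_in_enlarged_domain) (auto simp: X_def Y_def)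
      then have "(1 + p * \<sigma>) * ((1 - t) * Y (2 * n + i) (k + 1) + t * Y n k)
          \<le> (1 + p * \<sigma>) * (D * E * ((1 - t) * X (2 * n + i) (k + 1) + t * X n k) powr p)"
        using \<sigma> by (intro mult_left_mono) auto
      also have "\<dots> = (D * E * (1 + p * \<sigma>)) * ((1 - t) * X (2 * n + i) (k + 1) + t * X n k) powr p"
        by (simp only: mult_ac)
      finally show ?thesis using enlarge by (simp add: E_def)
    qed
    show ?thesis
      unfolding g_def
      using vis[of 0] vis[of 1] dom[OF I] dom[OF ch(1)] dom[OF ch(2)] strict[OF I] p
      by (intro bellman_midpoint_concave[OF p midX midY]) auto
  qed
  let ?G = "\<lambda>n k. ennreal (g n k)"
  let ?I = "dyadic n k"
  define u where "u j x = ennreal (X \<lfloor>x * 2 powi (k + int j)\<rfloor> (k + int j) powr (- \<rho>)) * indicator ?I x"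
    for j :: nat and x :: real
  have super': "?G (2 * n) (k + 1) + ?G (2 * n + 1) (k + 1) \<le> 2 * ?G n k" if I: "dyadic n k \<subseteq> J" for n k
  proof -
    note ch = dyadic_children_subset[OF I]
    have "?G (2 * n) (k + 1) + ?G (2 * n + 1) (k + 1) = ennreal (g (2 * n) (k + 1) + g (2 * n + 1) (k + 1))"
      using g_nonneg[OF ch(1)] g_nonneg[OF ch(2)] by simp
    also have "\<dots> \<le> ennreal (2 * g n k)"
      using super[OF I] by (intro ennreal_leI) simp
    finally show ?thesis using g_nonneg[OF I] by (simp add: ennreal_mult)
  qed
  have step: "integral\<^sup>N lebesgue (u j) \<le> ?G n k * ennreal (2 powi (- k))" for j
  proof -
    have "integral\<^sup>N lebesgue (u j) \<le> (\<integral>\<^sup>+x\<in>?I. ?G \<lfloor>x * 2 powi (k + int j)\<rfloor> (k + int j) \<partial>lebesgue)"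
      unfolding u_def
    proof (rule nn_integral_mono_AE)
      show "AE x in lebesgue. ennreal (X \<lfloor>x * 2 powi (k + int j)\<rfloor> (k + int j) powr - \<rho>) * indicator ?I x
         \<le> ?G \<lfloor>x * 2 powi (k + int j)\<rfloor> (k + int j) * indicator ?I x"
        using AE_not_dyadic_end[of n k]
      proof eventually_elim
        case (elim x)
        show ?case
        proof (cases "x \<in> ?I")
          case True
          have "dyadic \<lfloor>x * 2 powi (k + int j)\<rfloor> (k + int j) \<subseteq> J"
            using dyadic_floor_subset[OF True elim, of j] sub by blast
          from lower[OF this] show ?thesis
            by (auto intro!: mult_right_mono ennreal_leI)
        qed simp
      qed
    qed
    also have "\<dots> \<le> ?G n k * ennreal (2 powi (- k))"
      by (rule dyadic_supersolution_nn_integral[of J ?G, OF super' sub])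
    finally show ?thesis .
  qed
  have meas: "u j \<in> borel_measurable lebesgue" for j
  proof -
    have [measurable]: "(\<lambda>x::real. ennreal (X \<lfloor>x * 2 powi (k + int j)\<rfloor> (k + int j) powr (- \<rho>))) \<in> borel_measurable lebesgue"
      by (rule dyadic_step_measurable)
    show ?thesis unfolding u_def by measurable
  qed
  have lim: "AE x in lebesgue. liminf (\<lambda>j. u j x) = ennreal (w x powr (- \<rho>)) * indicator ?I x"
    using dyadic_averages_converge[OF weight_integrable_Icc[OF w], of k] w[unfolded weight_def, THEN conjunct2]
  proof eventually_elim
    case (elim x)
    have "(\<lambda>j. u j x) \<longlonglongrightarrow> ennreal (w x powr (- \<rho>)) * indicator ?I x"
      unfolding u_def X_def using elim
      by (cases "x \<in> ?I") (auto intro!: tendsto_intros)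
    then show ?case by (intro lim_imp_Liminf) auto
  qed
  have "(\<integral>\<^sup>+x\<in>?I. ennreal (w x powr (- \<rho>)) \<partial>lebesgue) = (\<integral>\<^sup>+x. liminf (\<lambda>j. u j x) \<partial>lebesgue)"
    using lim by (intro nn_integral_cong_AE) auto
  also have "\<dots> \<le> liminf (\<lambda>j. integral\<^sup>N lebesgue (u j))"
    by (intro nn_integral_liminf meas)
  also have "\<dots> \<le> ?G n k * ennreal (2 powi (- k))"
    using step by (intro Liminf_le) auto
  finally have "avg (\<lambda>x. w x powr (- \<rho>)) ?I \<le> ?G n k * ennreal (2 powi (- k)) / ennreal (2 powi (- k))"
    unfolding avg_def emeasure_dyadic by (intro divide_right_mono_ennreal)
  also have "\<dots> = ?G n k"
    by (simp add: mult_divide_eq_ennreal)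
  also have "\<dots> \<le> ennreal (Y n k powr (- \<rho> / p) / (1 - \<rho> * \<sigma>))"
    unfolding g_def using p dom[OF sub] by (intro ennreal_leI bellman_upper) auto
  finally show ?thesis by (simp add: Y_def)
qed

section \<open>The Muckenhoupt constants\<close>

lemma epowr_mono_ennreal:
  assumes "a \<le> ennreal c" "0 \<le> c" "0 \<le> r"
  shows "epowr a r \<le> ennreal (c powr r)"
proof -
  have "a \<noteq> \<infinity>" using assms(1) by (auto simp: top_unique)
  then obtain b where "0 \<le> b" "a = ennreal b" by (cases a) auto
  then show ?thesis
    using assms by (auto simp: epowr_def intro!: ennreal_leI powr_mono2)
qed

lemma A_const_le:
  assumes q: "1 < q" and bound: "\<And>n k. dyadic n k \<subseteq> J \<Longrightarrow> \<exists>a b. 0 \<le> a \<and> 0 \<le> b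
      \<and> avg v (dyadic n k) \<le> ennreal a \<and> avg (\<lambda>x. v x powr (- 1 / (q - 1))) (dyadic n k) \<le> ennreal b
      \<and> a * b powr (q - 1) \<le> C"
  shows "v \<in> A_class J q \<and> A_const J q v \<le> ennreal C"
proof -
  have "A_const J q v \<le> ennreal C"
    unfolding A_const_def
  proof (rule SUP_least)
    fix I assume "I \<in> dyadic_in J"
    then obtain n k where I: "I = dyadic n k" "dyadic n k \<subseteq> J"
      by (auto simp: dyadic_in_def dyadic_intervals_iff)
    obtain a b where ab: "0 \<le> a" "0 \<le> b" "avg v I \<le> ennreal a"
      "avg (\<lambda>x. v x powr (- 1 / (q - 1))) I \<le> ennreal b" "a * b powr (q - 1) \<le> C"
      using bound[OF I(2)] unfolding I(1) by blast
    have "avg v I * epowr (avg (\<lambda>x. v x powr (- 1 / (q - 1))) I) (q - 1)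
        \<le> ennreal a * ennreal (b powr (q - 1))"
    proof (rule mult_mono)
      show "epowr (avg (\<lambda>x. v x powr (- 1 / (q - 1))) I) (q - 1) \<le> ennreal (b powr (q - 1))"
        using q by (intro epowr_mono_ennreal ab) simp
    qed (simp_all add: ab(3))
    also have "\<dots> = ennreal (a * b powr (q - 1))"
      using ab by (simp add: ennreal_mult)
    also have "\<dots> \<le> ennreal C" using ab by (intro ennreal_leI)
    finally show "avg v I * epowr (avg (\<lambda>x. v x powr (- 1 / (q - 1))) I) (q - 1) \<le> ennreal C" .
  qed
  moreover from this have "A_const J q v < \<infinity>"
    by (rule le_less_trans) simp
  ultimately show ?thesis by (simp add: A_class_def)
qed

theorem corollary1p2:
  fixes p \<delta> Q \<epsilon> s :: real and J :: "real set" and w :: "real \<Rightarrow> real"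
  assumes "p > 1"
    and "J \<in> dyadic_intervals"
    and "weight w"
    and "Db w < \<infinity>"
    and "RH_const J p w < \<infinity>"
    and "\<delta> = enn2real (RH_const J p w)"
    and "Q = max (enn2real (Db w)) 2"
    and "\<epsilon> = eps p \<delta> Q"
    and "s = s_minus p \<epsilon>"
  shows "(\<forall>q > 1 - s. w \<in> A_class J q \<and>
            A_const J q w \<le> ennreal (((q - 1) / (q - 1 + s)) powr (q - 1))) \<and>
         (\<forall>q > 1 - p * s. (\<lambda>x. w x powr p) \<in> A_class J q \<and>
            A_const J q (\<lambda>x. w x powr p) \<le> ennreal (((q - 1) / (q - 1 + p * s)) powr (q - 1)))"
proof -
  note p = assms(1) and w = assms(3)
  define E where "E = chord_factor p ((Q powr p - 1) / (Q - 1))"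
  define D where "D = \<delta> powr p"
  define X where "X n k = dyadic_avg w n k" for n k
  define Y where "Y n k = dyadic_avg (\<lambda>x. w x powr p) n k" for n k
  have Q: "2 \<le> Q" using assms(7) by simp
  have X: "0 < X n k" for n k
    using weight_dyadic_avg_pos[OF w] by (simp add: X_def)
  note int = RH_const_avg_bound(1)[OF w p assms(5)]
  have RH: "Y n k \<le> D * X n k powr p" if "dyadic n k \<subseteq> J" for n k
    using RH_const_avg_bound(2)[OF w p assms(5) that] by (simp add: X_def Y_def D_def assms(6))
  have jensen: "X n k powr p \<le> Y n k" if "dyadic n k \<subseteq> J" for n k
    using dyadic_avg_jensen[OF w p int[OF that]] by (simp add: X_def Y_def)
  have Y: "0 < Y n k" if "dyadic n k \<subseteq> J" for n k
    using jensen[OF that] X[of n k] by (metis less_le_trans less_numeral_extra(3) powr_gt_zero)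
  have doubling: "X n k \<le> Q * X (2 * n + i) (k + 1)" if "i \<in> {0, 1}" for n k i
  proof -
    have "X n k \<le> enn2real (Db w) * X (2 * n + i) (k + 1)"
      using Db_avg_bound[OF w assms(4) that] by (simp add: X_def)
    also have "\<dots> \<le> Q * X (2 * n + i) (k + 1)"
      using X[of "2 * n + i" "k + 1"] assms(7) by (intro mult_right_mono) auto
    finally show ?thesis .
  qed
  have "1 \<le> D"
  proof -
    obtain n k where J: "J = dyadic n k" using assms(2) by (auto simp: dyadic_intervals_iff)
    have "1 * X n k powr p \<le> D * X n k powr p"
      using jensen[of n k] RH[of n k] by (simp add: J)
    then show ?thesis using X[of n k] by (simp add: mult_le_cancel_right_pos)
  qed
  have H: "p < (Q powr p - 1) / (Q - 1)" using p Q by (intro powr_slope_gt) auto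
  have E: "1 < E"
    unfolding E_def using p H by (rule chord_factor_gt_1)
  have eps_powr: "\<epsilon> powr p = D * E"
    unfolding assms(8) D_def E_def by (rule eps_powr_eq)
  have "D * 1 < D * E" using E \<open>1 \<le> D\<close> by (intro mult_strict_left_mono) auto
  then have "1 < D * E" using \<open>1 \<le> D\<close> by linarith
  have "0 \<le> \<epsilon>"
  proof -
    have "0 \<le> H_const p Q" using H p unfolding H_const_def by linarith
    then show ?thesis unfolding assms(8) eps_def using p by (simp add: assms(6))
  qed
  have "1 < \<epsilon>"
  proof (rule ccontr)
    assume "\<not> 1 < \<epsilon>"
    then have "\<epsilon> powr p \<le> 1" using p \<open>0 \<le> \<epsilon>\<close> by (intro powr_le1) auto
    then show False using eps_powr \<open>1 < D * E\<close> by simp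
  qed
  have s: "s < 0" "(1 - p * s) powr (1 / p) * inverse (1 - s) = 1 / \<epsilon>"
    using theI'[OF power_function_ratio_solution[OF p \<open>1 < \<epsilon>\<close>]]
    unfolding assms(9) s_minus_def by blast+
  define \<sigma> where "\<sigma> = - s"
  have \<sigma>: "0 < \<sigma>" "s = - \<sigma>" using s by (auto simp: \<sigma>_def)
  have p\<sigma>: "0 < p * \<sigma>" using p \<sigma> by simp
  have "\<epsilon> * (1 + p * \<sigma>) powr (1 / p) = 1 + \<sigma>"
    using s(2) \<sigma> \<open>1 < \<epsilon>\<close> by (simp add: field_simps)
  then have "(\<epsilon> * (1 + p * \<sigma>) powr (1 / p)) powr p = (1 + \<sigma>) powr p" by simp
  then have enlarge: "D * E * (1 + p * \<sigma>) = (1 + \<sigma>) powr p"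
    using p p\<sigma> by (simp add: powr_mult powr_powr eps_powr)
  have neg: "avg (\<lambda>x. w x powr (- \<rho>)) (dyadic n k) \<le> ennreal (Y n k powr (- \<rho> / p) / (1 - \<rho> * \<sigma>))"
    if "0 < \<rho>" "\<rho> * \<sigma> < 1" "dyadic n k \<subseteq> J" for \<rho> n k
    unfolding Y_def
    by (rule avg_neg_powr_le[OF p \<sigma>(1) that(1,2) Q _ w int RH[unfolded X_def Y_def]
            doubling[unfolded X_def] enlarge[unfolded E_def] that(3)])
      (use \<open>1 \<le> D\<close> in auto)
  have avg_w: "avg w (dyadic n k) = ennreal (X n k)" for n k
    unfolding X_def by (intro avg_dyadic weight_absolutely_integrable_dyadic weight_AE_nonneg w)
  have avg_wp: "avg (\<lambda>x. w x powr p) (dyadic n k) = ennreal (Y n k)" if "dyadic n k \<subseteq> J" for n k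
    unfolding Y_def by (intro avg_dyadic int that) auto
  show ?thesis
  proof (rule conjI; intro allI impI)
    \<comment> \<open>Part (i): \<open>\<rho> = 1 / (q - 1)\<close>; by Jensen's inequality \<open>Y powr (- 1 / p)\<close> is at most \<open>1 / X\<close>.\<close>
    fix q assume q: "1 - s < q"
    define \<rho> where "\<rho> = 1 / (q - 1)"
    have \<rho>: "0 < \<rho>" "\<rho> * \<sigma> < 1" "\<rho> * (q - 1) = 1" "1 < q"
      using q \<sigma> by (auto simp: \<rho>_def)
    have frac: "1 / (1 - \<rho> * \<sigma>) = (q - 1) / (q - 1 + s)"
      using \<rho> \<sigma>(2) q by (simp add: \<rho>_def field_simps)
    show "w \<in> A_class J q \<and> A_const J q w \<le> ennreal (((q - 1) / (q - 1 + s)) powr (q - 1))"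
    proof (rule A_const_le[OF \<rho>(4)])
      fix n k assume I: "dyadic n k \<subseteq> J"
      let ?b = "Y n k powr (- \<rho> / p) / (1 - \<rho> * \<sigma>)"
      have 1: "avg w (dyadic n k) \<le> ennreal (X n k)" by (simp add: avg_w)
      have 2: "avg (\<lambda>x. w x powr (- 1 / (q - 1))) (dyadic n k) \<le> ennreal ?b"
        using neg[OF \<rho>(1,2) I] by (simp add: \<rho>_def)
      have 3: "0 \<le> X n k" "0 \<le> ?b" using X[of n k] \<rho> by auto
      have "X n k = (X n k powr p) powr (1 / p)" using X[of n k] p by (simp add: powr_powr)
      also have "\<dots> \<le> Y n k powr (1 / p)"
        using jensen[OF I] p by (intro powr_mono2) auto
      finally have "X n k * Y n k powr (- (1 / p)) \<le> 1"
        using Y[OF I] by (simp add: powr_minus field_simps)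
      have "?b powr (q - 1) = (Y n k powr (- \<rho> / p)) powr (q - 1) * (1 / (1 - \<rho> * \<sigma>)) powr (q - 1)"
        unfolding powr_mult[symmetric] by simp
      also have "(Y n k powr (- \<rho> / p)) powr (q - 1) = Y n k powr (- (1 / p))"
        using \<rho>(3) by (simp add: powr_powr)
      finally have "X n k * ?b powr (q - 1) = (X n k * Y n k powr (- (1 / p))) * ((q - 1) / (q - 1 + s)) powr (q - 1)"
        by (simp add: frac)
      also have "\<dots> \<le> 1 * ((q - 1) / (q - 1 + s)) powr (q - 1)"
        using \<open>X n k * Y n k powr (- (1 / p)) \<le> 1\<close> by (intro mult_right_mono) auto
      finally have 4: "X n k * ?b powr (q - 1) \<le> ((q - 1) / (q - 1 + s)) powr (q - 1)" by simp
      show "\<exists>a b. 0 \<le> a \<and> 0 \<le> b \<and> avg w (dyadic n k) \<le> ennreal a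
          \<and> avg (\<lambda>x. w x powr (- 1 / (q - 1))) (dyadic n k) \<le> ennreal b
          \<and> a * b powr (q - 1) \<le> ((q - 1) / (q - 1 + s)) powr (q - 1)"
        by (intro exI[of _ "X n k"] exI[of _ ?b] conjI 1 2 3 4)
    qed
  next
    \<comment> \<open>Part (ii): the dual weight of \<open>w powr p\<close> is \<open>w powr (- \<rho>)\<close> with \<open>\<rho> = p / (q - 1)\<close>, and the powers of
      \<open>Y\<close> cancel.\<close>
    fix q assume q: "1 - p * s < q"
    define \<rho> where "\<rho> = p / (q - 1)"
    have "1 < q" using q \<sigma> p\<sigma> by simp
    then have \<rho>: "0 < \<rho>" "\<rho> * \<sigma> < 1" "\<rho> * (q - 1) = p" "1 < q"
      using q \<sigma> p by (auto simp: \<rho>_def)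
    have frac: "1 / (1 - \<rho> * \<sigma>) = (q - 1) / (q - 1 + p * s)"
      using \<rho> \<sigma>(2) q by (simp add: \<rho>_def field_simps)
    show "(\<lambda>x. w x powr p) \<in> A_class J q \<and>
        A_const J q (\<lambda>x. w x powr p) \<le> ennreal (((q - 1) / (q - 1 + p * s)) powr (q - 1))"
    proof (rule A_const_le[OF \<rho>(4)])
      fix n k assume I: "dyadic n k \<subseteq> J"
      let ?b = "Y n k powr (- \<rho> / p) / (1 - \<rho> * \<sigma>)"
      have 1: "avg (\<lambda>x. w x powr p) (dyadic n k) \<le> ennreal (Y n k)" by (simp add: avg_wp I)
      have 2: "avg (\<lambda>x. (w x powr p) powr (- 1 / (q - 1))) (dyadic n k) \<le> ennreal ?b"
        using neg[OF \<rho>(1,2) I] by (simp add: \<rho>_def powr_powr)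
      have 3: "0 \<le> Y n k" "0 \<le> ?b" using Y[OF I] \<rho> by auto
      have "?b powr (q - 1) = (Y n k powr (- \<rho> / p)) powr (q - 1) * (1 / (1 - \<rho> * \<sigma>)) powr (q - 1)"
        unfolding powr_mult[symmetric] by simp
      also have "(Y n k powr (- \<rho> / p)) powr (q - 1) = Y n k powr (- 1)"
        using \<rho>(3) p by (simp add: powr_powr)
      finally have "Y n k * ?b powr (q - 1) = (Y n k * Y n k powr (- 1)) * ((q - 1) / (q - 1 + p * s)) powr (q - 1)"
        by (simp add: frac)
      also have "Y n k * Y n k powr (- 1) = 1"
        using Y[OF I] by (simp add: powr_minus)
      finally have 4: "Y n k * ?b powr (q - 1) \<le> ((q - 1) / (q - 1 + p * s)) powr (q - 1)" by simp
      show "\<exists>a b. 0 \<le> a \<and> 0 \<le> b \<and> avg (\<lambda>x. w x powr p) (dyadic n k) \<le> ennreal a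
          \<and> avg (\<lambda>x. (w x powr p) powr (- 1 / (q - 1))) (dyadic n k) \<le> ennreal b
          \<and> a * b powr (q - 1) \<le> ((q - 1) / (q - 1 + p * s)) powr (q - 1)"
        by (intro exI[of _ "Y n k"] exI[of _ ?b] conjI 1 2 3 4)
    qed
  qed
qed

end
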